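(* Let $p>0$ be a constant, let $K:[0,1]\times\mathbb{R}\to\mathbb{R}$ be a function and $L:H^2(0,1)\cap H_0^1(0,1)\to\mathbb{R}$ a functional satisfying $|L(w)|\le\|w\|$ and $|K(x,y)|\le|y|$ for all $x\in[0,1]$, $y\in\mathbb{R}$, $w\in H^2(0,1)\cap H_0^1(0,1)$. Consider the system $$w_t(t,x)=p\,w_{xx}(t,x)+\theta_1(t)K(x,y(t)),\quad w(t,0)=w(t,1)=0,\qquad \dot y=u+\theta_2(t)L(w[t])+d(t),$$ with the controller $$u=-c\Big(1+\frac{(b+\exp(z))^7}{4a^6}\Big)(y^7+y^3+y),\qquad \dot z=\Gamma\exp(-z)\big(y^2/2-\varepsilon\big)^+,$$ where $\varepsilon,\Gamma>0$, $c\ge1$, $b\ge1\ge a>0$ are constants. Let $d\in L^\infty(\mathbb{R}_+)$ and $\theta=(\theta_1,\theta_2)\in C^0(\mathbb{R}_+;\mathbb{R}^2)\cap L^\infty(\mathbb{R}_+;\mathbb{R}^2)$. Let $w\in C^0(\mathbb{R}_+;L^2(0,1))\cap C^1((0,+\infty);L^2(0,1))\cap C^0((0,+\infty);H^2(0,1)\cap H_0^1(0,1))$, $z\in C^1(\mathbb{R}_+;\mathbb{R})$, and $y\in C^0(\mathbb{R}_+;\mathbb{R})$ absolutely continuous on every compact interval of $\mathbb{R}_+$, be such that the PDE, the formula for $u$ and the equation for $\dot z$ hold for all $t\in(0,+\infty)$, and the equation for $\dot y$ holds for a.e. $t\in(0,+\infty)$. Then for all $t\ge0$: $$\|w[t]\|^2+y^2(t)\le\exp(-\kappa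 t)\big(\|w[0]\|^2+y^2(0)\big)+2a\frac{\|d\|_\infty^2+\|\theta\|_\infty^8+2p^{-2}}{b\kappa}+\frac{\|\theta\|_\infty^4}{2p^2\pi^4\kappa},$$ $$z(0)\le z(t)\le\ln\Big(\exp(z(0))+\bar B\big(\|d\|_\infty^2+\|\theta\|_\infty^4+\|\theta\|_\infty^8+2p^{-2}+\|w[0]\|^2+y^2(0)\big)\Big),$$ $$\limsup_{t\to+\infty}\|w[t]\|\le\frac{\sqrt{2\varepsilon}}{p\pi^2}\limsup_{t\to+\infty}|\theta_1(t)|,\qquad \limsup_{t\to+\infty}|y(t)|\le\sqrt{2\varepsilon},$$ where $\kappa=\min\big(\frac{p\pi^2}{2},2c\big)$, $\bar K=\frac{4p\pi^2(b\kappa+ap\pi^2)+2b\kappa p^2\pi^4+b}{4p\pi^2b\kappa}$ and $\bar B=\frac{a\bar K(\varepsilon\Gamma+2c)+\varepsilon c\Gamma}{4c^2\varepsilon}$.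
   Context: $\|\cdot\|$ denotes the norm of $L^2(0,1)$; $w[t]$ denotes the function $x\mapsto w(t,x)$. $H^k(0,1)$ is the Sobolev space and $H_0^1(0,1)$ the closure in $H^1(0,1)$ of compactly supported $C^1$ functions. $\|d\|_\infty$, $\|\theta\|_\infty$ denote essential suprema of $|d(t)|$ and of the Euclidean norm $|\theta(t)|$. $x^+=\max(x,0)$. *)

theory Defs
  imports "HOL-Analysis.Analysis" "HOL-Probability.Essential_Supremum"
begin

definition in_L2 :: "(real \<Rightarrow> real) \<Rightarrow> bool" where
  "in_L2 f \<longleftrightarrow> f \<in> borel_measurable (lebesgue_on {0..1}) \<and>
     integrable (lebesgue_on {0..1}) (\<lambda>x. (f x)^2)"

definition L2norm :: "(real \<Rightarrow> real) \<Rightarrow> real" where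
  "L2norm f = sqrt (integral\<^sup>L (lebesgue_on {0..1}) (\<lambda>x. (f x)^2))"

(* f belongs to H^2(0,1), with f' its (classical = weak) first derivative on [0,1]
   and f'' its weak second derivative: f is C^1 on [0,1], f' is absolutely continuous
   with f'(x) = f'(0) + int_0^x f'', and f'' \<in> L^2(0,1).  (Continuous representative.) *)
definition H2_with :: "(real \<Rightarrow> real) \<Rightarrow> (real \<Rightarrow> real) \<Rightarrow> (real \<Rightarrow> real) \<Rightarrow> bool" where
  "H2_with f f' f'' \<longleftrightarrow>
     (\<forall>x\<in>{0..1}. (f has_real_derivative f' x) (at x within {0..1})) \<and>
     in_L2 f'' \<and>
     (\<forall>x\<in>{0..1}. f' x = f' 0 + integral\<^sup>L (lebesgue_on {0..x}) f'')"

definition H2_H01 :: "(real \<Rightarrow> real) \<Rightarrow> bool" where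
  "H2_H01 f \<longleftrightarrow> (\<exists>f' f''. H2_with f f' f'') \<and> f 0 = 0 \<and> f 1 = 0"

definition L2_continuous_on :: "real set \<Rightarrow> (real \<Rightarrow> real \<Rightarrow> real) \<Rightarrow> bool" where
  "L2_continuous_on S v \<longleftrightarrow> (\<forall>t\<in>S. in_L2 (v t) \<and>
     ((\<lambda>s. L2norm (\<lambda>x. v s x - v t x)) \<longlongrightarrow> 0) (at t within S))"

definition abs_cont_on :: "real \<Rightarrow> real \<Rightarrow> (real \<Rightarrow> real) \<Rightarrow> bool" where
  "abs_cont_on a b f \<longleftrightarrow> (\<forall>e>0. \<exists>\<delta>>0. \<forall>n::nat. \<forall>l r::nat \<Rightarrow> real.
     ((\<forall>i<n. a \<le> l i \<and> l i \<le> r i \<and> r i \<le> b) \<and>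
      (\<forall>i<n. \<forall>j<n. i \<noteq> j \<longrightarrow> r i \<le> l j \<or> r j \<le> l i) \<and>
      (\<Sum>i<n. r i - l i) < \<delta>) \<longrightarrow> (\<Sum>i<n. \<bar>f (r i) - f (l i)\<bar>) < e)"

definition ess_norm :: "(real \<Rightarrow> real) \<Rightarrow> real" where
  "ess_norm g = real_of_ereal (esssup (lebesgue_on {0..}) (\<lambda>t. ereal \<bar>g t\<bar>))"

definition in_Linf :: "(real \<Rightarrow> real) \<Rightarrow> bool" where
  "in_Linf g \<longleftrightarrow> g \<in> borel_measurable (lebesgue_on {0..}) \<and>
     (\<exists>B. AE t in lebesgue_on {0..}. \<bar>g t\<bar> \<le> B)"

end

(*
  Testing the heat equation with w and using the sharp Poincare inequality gives
  (|w|^2)' <= -2 p pi^2 |w|^2 + 2 |theta1| |y| |w|. Young's inequality, paid for by the y^8, y^4, y^2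
  damping of the controller, turns this into a linear differential inequality for |w|^2 + y^2, and, with
  that bound on |w| inserted, into (y^2/2)' <= -c y^2 + a C / (b + exp z) for a constant C.
  Hence once b + exp z exceeds a C / (2 c eps) the excess of y^2/2 over eps decays exponentially,
  so the gain exp z, whose derivative is Gamma (y^2/2 - eps)^+, stays bounded. Boundedness of the
  gain forces limsup y^2/2 <= eps by Barbalat's argument, and the energy inequality for w
  yields the remaining limit superior.
*)

theory Submission
  imports Defs
begin

subsection \<open>Square-integrable functions\<close>

lemma integrable_mult_of_squares:
  fixes f g :: "'a \<Rightarrow> real"
  assumes [measurable]: "f \<in> borel_measurable M" "g \<in> borel_measurable M"
    and "integrable M (\<lambda>x. (f x)^2)" "integrable M (\<lambda>x. (g x)^2)"
  shows "integrable M (\<lambda>x. f x * g x)"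
proof (rule Bochner_Integration.integrable_bound)
  show "integrable M (\<lambda>x. ((f x)^2 + (g x)^2) / 2)"
    using assms by simp
  have "\<bar>f x * g x\<bar> \<le> ((f x)^2 + (g x)^2) / 2" for x
    using sum_squares_bound[of "\<bar>f x\<bar>" "\<bar>g x\<bar>"] by (simp add: abs_mult)
  then show "AE x in M. norm (f x * g x) \<le> norm (((f x)^2 + (g x)^2) / 2)"
    by (intro AE_I2) (simp add: order_trans[OF _ abs_ge_self])
qed measurable

lemma Cauchy_Schwarz_integral:
  fixes f g :: "'a \<Rightarrow> real"
  assumes [measurable]: "f \<in> borel_measurable M" "g \<in> borel_measurable M"
    and f_square: "integrable M (\<lambda>x. (f x)^2)" and g_square: "integrable M (\<lambda>x. (g x)^2)"
  shows "(\<integral>x. f x * g x \<partial>M)^2 \<le> (\<integral>x. (f x)^2 \<partial>M) * (\<integral>x. (g x)^2 \<partial>M)"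
proof (cases "(\<integral>x. (g x)^2 \<partial>M) = 0")
  case True
  then have "AE x in M. (g x)^2 = 0"
    using integral_nonneg_eq_0_iff_AE[OF g_square] by simp
  then have "(\<integral>x. f x * g x \<partial>M) = (\<integral>x. 0 \<partial>M)"
    by (intro integral_cong_AE) auto
  then show ?thesis using True by simp
next
  case False
  define F G I where "F = (\<integral>x. (f x)^2 \<partial>M)" and "G = (\<integral>x. (g x)^2 \<partial>M)" and "I = (\<integral>x. f x * g x \<partial>M)"
  note fg_integrable = integrable_mult_of_squares[OF assms]
  have "G \<ge> 0"
    unfolding G_def by (intro integral_nonneg_AE) auto
  then have "G > 0"
    using False unfolding G_def by linarith
  have "0 \<le> (\<integral>x. (G * f x - I * g x)^2 \<partial>M)"
    by (intro integral_nonneg_AE) auto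
  also have "(\<lambda>x. (G * f x - I * g x)^2)
      = (\<lambda>x. G^2 * (f x)^2 - (2 * G * I) * (f x * g x) + I^2 * (g x)^2)"
    by (auto simp: power2_eq_square algebra_simps)
  also have "integral\<^sup>L M \<dots> = G^2 * F - (2 * G * I) * I + I^2 * G"
    using f_square g_square fg_integrable unfolding F_def G_def I_def by simp
  also have "\<dots> = G * (F * G - I^2)"
    by (simp add: power2_eq_square algebra_simps)
  finally have "I^2 \<le> F * G"
    using \<open>G > 0\<close> by (simp add: zero_le_mult_iff)
  then show ?thesis unfolding F_def G_def I_def .
qed

definition L2inner :: "(real \<Rightarrow> real) \<Rightarrow> (real \<Rightarrow> real) \<Rightarrow> real" where
  "L2inner f g = (\<integral>x. f x * g x \<partial>lebesgue_on {0..1})"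

lemma in_L2_integrable_mult:
  assumes "in_L2 f" "in_L2 g"
  shows "integrable (lebesgue_on {0..1}) (\<lambda>x. f x * g x)"
  using assms integrable_mult_of_squares unfolding in_L2_def by blast

lemma in_L2_continuous:
  assumes "continuous_on {0..1} f"
  shows "in_L2 f"
  unfolding in_L2_def using assms
  by (auto intro!: continuous_imp_integrable_real continuous_imp_measurable_on_sets_lebesgue
      continuous_on_power)

lemma in_L2_imp_integrable:
  assumes "in_L2 f"
  shows "integrable (lebesgue_on {0..1}) f"
  using in_L2_integrable_mult[OF assms in_L2_continuous[of "\<lambda>x. 1"]] by simp

lemma in_L2_add:
  assumes "in_L2 f" "in_L2 g"
  shows "in_L2 (\<lambda>x. f x + g x)"
proof -
  have "integrable (lebesgue_on {0..1}) (\<lambda>x. (f x)^2 + (g x)^2 + 2 * (f x * g x))"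
    using assms in_L2_integrable_mult[OF assms] unfolding in_L2_def by simp
  then show ?thesis
    using assms unfolding in_L2_def by (auto simp: power2_sum algebra_simps)
qed

lemma in_L2_cmult: "in_L2 f \<Longrightarrow> in_L2 (\<lambda>x. k * f x)"
  unfolding in_L2_def by (auto simp: power_mult_distrib)

lemma in_L2_diff:
  assumes "in_L2 f" "in_L2 g"
  shows "in_L2 (\<lambda>x. f x - g x)"
  using in_L2_add[OF assms(1) in_L2_cmult[OF assms(2), of "-1"]] by simp

lemma L2inner_commute: "L2inner f g = L2inner g f"
  unfolding L2inner_def by (simp add: mult.commute)

lemma L2inner_cmult_right: "L2inner f (\<lambda>x. k * g x) = k * L2inner f g"
  unfolding L2inner_def by (simp add: mult.left_commute)

lemma L2inner_add_right:
  assumes "in_L2 f" "in_L2 g" "in_L2 h"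
  shows "L2inner f (\<lambda>x. g x + h x) = L2inner f g + L2inner f h"
  using in_L2_integrable_mult[OF assms(1,2)] in_L2_integrable_mult[OF assms(1,3)]
  unfolding L2inner_def by (simp add: distrib_left)

lemma L2inner_diff_right:
  assumes "in_L2 f" "in_L2 g" "in_L2 h"
  shows "L2inner f (\<lambda>x. g x - h x) = L2inner f g - L2inner f h"
  using L2inner_add_right[OF assms(1,2) in_L2_cmult[OF assms(3), of "-1"]]
    L2inner_cmult_right[of f "-1" h] by simp

lemma L2inner_diff_left:
  assumes "in_L2 f" "in_L2 g" "in_L2 h"
  shows "L2inner (\<lambda>x. f x - g x) h = L2inner f h - L2inner g h"
  using L2inner_diff_right[OF assms(3,1,2)] by (simp only: L2inner_commute[of h])

lemma L2norm_nonneg [simp]: "L2norm f \<ge> 0"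
  unfolding L2norm_def by (intro real_sqrt_ge_zero integral_nonneg_AE) auto

lemma L2norm_power2: "(L2norm f)^2 = L2inner f f"
  unfolding L2norm_def L2inner_def power2_eq_square[symmetric]
  by (intro real_sqrt_pow2 integral_nonneg_AE) auto

lemma L2_Cauchy_Schwarz:
  assumes "in_L2 f" "in_L2 g"
  shows "\<bar>L2inner f g\<bar> \<le> L2norm f * L2norm g"
proof (rule power2_le_imp_le)
  show "\<bar>L2inner f g\<bar>^2 \<le> (L2norm f * L2norm g)^2"
    using assms Cauchy_Schwarz_integral[of f "lebesgue_on {0..1}" g]
    unfolding in_L2_def power_mult_distrib L2norm_power2 power2_abs L2inner_def
    by (simp add: power2_eq_square)
qed simp

lemma L2norm_le_of_AE_bound:
  assumes f: "in_L2 f" and bound: "AE x in lebesgue_on {0..1}. \<bar>f x\<bar> \<le> m" and "m \<ge> 0"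
  shows "L2norm f \<le> m"
proof (rule power2_le_imp_le)
  have "(L2norm f)^2 \<le> (\<integral>x. m^2 \<partial>lebesgue_on {0..1::real})"
    unfolding L2norm_power2 L2inner_def power2_eq_square[symmetric]
  proof (rule integral_mono_AE)
    show "AE x in lebesgue_on {0..1}. (f x)^2 \<le> m^2"
      using bound by eventually_elim (metis abs_ge_zero power2_abs power_mono)
  qed (use f in \<open>auto simp: in_L2_def intro!: continuous_imp_integrable_real\<close>)
  then show "(L2norm f)^2 \<le> m^2"
    by (simp add: measure_restrict_space)
qed fact

lemma L2inner_tendsto:
  assumes f: "in_L2 f" and g: "in_L2 g"
    and u: "\<forall>\<^sub>F s in F. in_L2 (u s)" and v: "\<forall>\<^sub>F s in F. in_L2 (v s)"
    and u_lim: "((\<lambda>s. L2norm (\<lambda>x. u s x - f x)) \<longlongrightarrow> 0) F"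
    and v_lim: "((\<lambda>s. L2norm (\<lambda>x. v s x - g x)) \<longlongrightarrow> 0) F"
  shows "((\<lambda>s. L2inner (u s) (v s)) \<longlongrightarrow> L2inner f g) F"
proof (rule LIM_zero_cancel, rule Lim_null_comparison)
  define \<delta>u \<delta>v where "\<delta>u s = (\<lambda>x. u s x - f x)" and "\<delta>v s = (\<lambda>x. v s x - g x)" for s
  let ?bound = "\<lambda>s. L2norm (\<delta>u s) * L2norm (\<delta>v s) + L2norm (\<delta>u s) * L2norm g + L2norm f * L2norm (\<delta>v s)"
  have "(?bound \<longlongrightarrow> 0 * 0 + 0 * L2norm g + L2norm f * 0) F"
    using u_lim v_lim unfolding \<delta>u_def \<delta>v_def by (intro tendsto_intros)
  then show "(?bound \<longlongrightarrow> 0) F" by simp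
  show "\<forall>\<^sub>F s in F. norm (L2inner (u s) (v s) - L2inner f g) \<le> ?bound s"
    using u v
  proof eventually_elim
    case (elim s)
    then have \<delta>: "in_L2 (\<delta>u s)" "in_L2 (\<delta>v s)"
      unfolding \<delta>u_def \<delta>v_def by (auto intro: in_L2_diff f g)
    have "L2inner (u s) (v s) - L2inner f g
        = L2inner (\<delta>u s) (\<delta>v s) + L2inner (\<delta>u s) g + L2inner f (\<delta>v s)"
      using elim f g \<delta> unfolding \<delta>u_def \<delta>v_def
      by (simp add: L2inner_diff_left L2inner_diff_right)
    moreover note L2_Cauchy_Schwarz[OF \<delta>] L2_Cauchy_Schwarz[OF \<delta>(1) g] L2_Cauchy_Schwarz[OF f \<delta>(2)]
    ultimately show ?case by simp
  qed
qed

lemma L2_continuous_on_subset: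
  assumes "L2_continuous_on S v" "T \<subseteq> S"
  shows "L2_continuous_on T v"
  using assms tendsto_within_subset[OF _ assms(2)] unfolding L2_continuous_on_def by blast

lemma L2_continuous_on_inner:
  assumes u: "L2_continuous_on S u" and v: "L2_continuous_on S v"
  shows "continuous_on S (\<lambda>t. L2inner (u t) (v t))"
  unfolding continuous_on_def
proof
  fix t assume "t \<in> S"
  moreover have "\<forall>\<^sub>F s in at t within S. in_L2 (u s)" "\<forall>\<^sub>F s in at t within S. in_L2 (v s)"
    using u v unfolding L2_continuous_on_def eventually_at_filter by auto
  ultimately show "((\<lambda>t. L2inner (u t) (v t)) \<longlongrightarrow> L2inner (u t) (v t)) (at t within S)"
    using u v unfolding L2_continuous_on_def by (intro L2inner_tendsto) auto
qed

lemma L2norm_power2_has_real_derivative: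
  assumes w: "L2_continuous_on S w" and "open S" "t \<in> S" and w': "in_L2 w'"
    and w'_lim: "((\<lambda>s. L2norm (\<lambda>x. (w s x - w t x) / (s - t) - w' x)) \<longlongrightarrow> 0) (at t)"
  shows "((\<lambda>s. (L2norm (w s))^2) has_real_derivative 2 * L2inner (w t) w') (at t)"
  unfolding has_field_derivative_iff
proof -
  define q where "q s = (\<lambda>x. (w s x - w t x) / (s - t))" for s
  have wt: "in_L2 (w t)" and w_lim: "((\<lambda>s. L2norm (\<lambda>x. w s x - w t x)) \<longlongrightarrow> 0) (at t)"
    using w \<open>t \<in> S\<close> unfolding L2_continuous_on_def
      at_within_open[OF \<open>t \<in> S\<close> \<open>open S\<close>, symmetric] by blast+
  have ev_w: "\<forall>\<^sub>F s in at t. in_L2 (w s)"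
    using eventually_at_in_open'[OF \<open>open S\<close> \<open>t \<in> S\<close>] w unfolding L2_continuous_on_def
    by (auto elim: eventually_mono)
  then have ev_q: "\<forall>\<^sub>F s in at t. in_L2 (q s)"
  proof eventually_elim
    case (elim s)
    then show ?case
      using in_L2_cmult[OF in_L2_diff[OF _ wt], of "w s" "1 / (s - t)"] unfolding q_def by simp
  qed
  have "((\<lambda>s. L2inner (w s) (q s)) \<longlongrightarrow> L2inner (w t) w') (at t)"
    using w'_lim w_lim ev_w ev_q wt w' unfolding q_def by (intro L2inner_tendsto)
  moreover have "((\<lambda>s. L2inner (w t) (q s)) \<longlongrightarrow> L2inner (w t) w') (at t)"
    using w'_lim ev_q wt w' unfolding q_def by (intro L2inner_tendsto) (auto simp: L2norm_def)
  ultimately have "((\<lambda>s. L2inner (w s) (q s) + L2inner (w t) (q s)) \<longlongrightarrow> 2 * L2inner (w t) w') (at t)"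
    unfolding mult_2 by (rule tendsto_add)
  moreover have "\<forall>\<^sub>F s in at t. L2inner (w s) (q s) + L2inner (w t) (q s)
      = ((L2norm (w s))^2 - (L2norm (w t))^2) / (s - t)"
    using ev_w
  proof eventually_elim
    case (elim s)
    have "L2inner f (q s) = (L2inner f (w s) - L2inner f (w t)) / (s - t)" if "in_L2 f" for f
      using L2inner_cmult_right[of f "1 / (s - t)" "\<lambda>x. w s x - w t x"]
        L2inner_diff_right[OF that elim wt]
      unfolding q_def by simp
    then show ?case
      using elim wt unfolding L2norm_power2
      by (simp add: L2inner_commute[of "w t" "w s"] add_divide_distrib[symmetric])
  qed
  ultimately show "((\<lambda>s. ((L2norm (w s))^2 - (L2norm (w t))^2) / (s - t)) \<longlongrightarrow> 2 * L2inner (w t) w')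
      (at t)"
    by (rule Lim_transform_eventually)
qed

subsection \<open>Almost everywhere on the real line\<close>

lemma AE_lebesgue_on_iff_negligible:
  assumes "S \<in> sets lebesgue"
  shows "(AE t in lebesgue_on S. P t) \<longleftrightarrow> negligible {t \<in> S. \<not> P t}"
proof -
  have "(AE t in lebesgue_on S. P t) \<longleftrightarrow> (AE t in lebesgue. t \<in> S \<longrightarrow> P t)"
    using assms by (simp add: AE_restrict_space_iff)
  also have "\<dots> \<longleftrightarrow> negligible {t \<in> S. \<not> P t}"
  proof -
    have "{t. \<not> (t \<in> S \<longrightarrow> P t)} = {t \<in> S. \<not> P t}" by auto
    then show ?thesis
      unfolding eventually_ae_filter_negligible by (metis negligible_subset order_refl)
  qed
  finally show ?thesis .
qed

lemma AE_lebesgue_on_subset: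
  assumes "AE t in lebesgue_on S. P t" "T \<subseteq> S" "S \<in> sets lebesgue" "T \<in> sets lebesgue"
  shows "AE t in lebesgue_on T. P t"
  using assms by (auto simp: AE_lebesgue_on_iff_negligible elim!: negligible_subset)

lemma AE_lebesgue_on_greaterThanI:
  fixes T :: real
  assumes "\<And>t. T < t \<Longrightarrow> P t"
  shows "AE t in lebesgue_on {T<..}. P t"
  using assms by (intro AE_I2) simp

lemma AE_lebesgue_on_greaterThan: "AE t in lebesgue_on {T::real<..}. T < t"
  by (rule AE_lebesgue_on_greaterThanI)

lemma negligible_outer_open:
  fixes N :: "real set"
  assumes N: "negligible N" and "\<delta> > 0"
  obtains U where "open U" "N \<subseteq> U" "U \<in> lmeasurable" "measure lebesgue U < \<delta>"
proof -
  obtain U where U: "open U" "N \<subseteq> U" "U - N \<in> lmeasurable" "emeasure lebesgue (U - N) < ennreal \<delta>"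
    using sets_lebesgue_outer_open[OF negligible_imp_sets[OF N] \<open>\<delta> > 0\<close>] by blast
  have "U \<in> lmeasurable"
    using fmeasurable.Un[OF U(3) negligible_imp_measurable[OF N]] U(2) by (simp add: Un_absorb2)
  moreover have "measure lebesgue U = measure lebesgue (U - N)"
    using N by (simp add: measure_Diff_null_set negligible_iff_null_sets
        fmeasurableD[OF \<open>U \<in> lmeasurable\<close>])
  moreover have "measure lebesgue (U - N) < \<delta>"
    using U(3,4) \<open>\<delta> > 0\<close> by (simp add: emeasure_eq_measure2 ennreal_less_iff)
  ultimately show thesis using that[OF U(1,2)] by simp
qed

lemma continuous_on_AE_le_imp_le:
  fixes g :: "real \<Rightarrow> real"
  assumes "open S" and cont: "continuous_on S g" and bound: "AE t in lebesgue_on S. g t \<le> B" and "t \<in> S"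
  shows "g t \<le> B"
proof -
  have "open (S \<inter> g -` {B<..})"
    using cont \<open>open S\<close> by (intro continuous_open_preimage) auto
  moreover have "S \<inter> g -` {B<..} = {t \<in> S. \<not> g t \<le> B}" by auto
  then have "negligible (S \<inter> g -` {B<..})"
    using bound \<open>open S\<close> by (simp add: AE_lebesgue_on_iff_negligible)
  ultimately have "S \<inter> g -` {B<..} = {}"
    using open_not_negligible by blast
  then show ?thesis using \<open>t \<in> S\<close> by force
qed

lemma in_Linf_AE_le_ess_norm:
  assumes "in_Linf g"
  shows "AE t in lebesgue_on {0..}. \<bar>g t\<bar> \<le> ess_norm g"
proof -
  let ?M = "lebesgue_on {0::real..}"
  define E where "E = esssup ?M (\<lambda>t. ereal \<bar>g t\<bar>)"
  obtain B where [measurable]: "g \<in> borel_measurable ?M" and bounded: "AE t in ?M. \<bar>g t\<bar> \<le> B"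
    using assms unfolding in_Linf_def by blast
  have AE_le: "AE t in ?M. ereal \<bar>g t\<bar> \<le> E"
    unfolding E_def by (rule esssup_AE)
  have "E \<le> ereal B"
    unfolding E_def using bounded by (intro esssup_I) auto
  moreover have "E \<noteq> - \<infinity>"
  proof
    assume "E = - \<infinity>"
    with AE_le have "AE t in ?M. False" by simp
    then have "negligible {0::real..}"
      by (simp add: AE_lebesgue_on_iff_negligible atLeast_def)
    then have "negligible {0::real<..}"
      by (rule negligible_subset) auto
    then show False
      using open_not_negligible[of "{0::real<..}"] by simp
  qed
  ultimately have "E = ereal (ess_norm g)"
    unfolding ess_norm_def E_def[symmetric] by (cases E) auto
  with AE_le show ?thesis by simp
qed

lemma in_Linf_sqrt_sum_squares:
  assumes f: "in_Linf f" and g: "in_Linf g"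
  shows "in_Linf (\<lambda>t. sqrt ((f t)^2 + (g t)^2))"
proof -
  have [measurable]: "f \<in> borel_measurable (lebesgue_on {0..})"
    "g \<in> borel_measurable (lebesgue_on {0..})"
    using f g unfolding in_Linf_def by blast+
  have "AE t in lebesgue_on {0..}. \<bar>sqrt ((f t)^2 + (g t)^2)\<bar> \<le> ess_norm f + ess_norm g"
    using in_Linf_AE_le_ess_norm[OF f] in_Linf_AE_le_ess_norm[OF g]
  proof eventually_elim
    case (elim t)
    then show ?case using sqrt_sum_squares_le_sum_abs[of "f t" "g t"] by simp
  qed
  moreover have "(\<lambda>t. sqrt ((f t)^2 + (g t)^2)) \<in> borel_measurable (lebesgue_on {0..})"
    by measurable
  ultimately show ?thesis unfolding in_Linf_def by blast
qed

lemma sum_squares_le_ess_norm: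
  assumes f: "in_Linf f" "continuous_on {0..} f" and g: "in_Linf g" "continuous_on {0..} g" and "t > 0"
  shows "(f t)^2 + (g t)^2 \<le> (ess_norm (\<lambda>t. sqrt ((f t)^2 + (g t)^2)))^2"
proof -
  let ?n = "\<lambda>t. sqrt ((f t)^2 + (g t)^2)"
  have "AE t in lebesgue_on {0<..}. \<bar>?n t\<bar> \<le> ess_norm ?n"
    by (rule AE_lebesgue_on_subset[OF in_Linf_AE_le_ess_norm])
      (auto intro: in_Linf_sqrt_sum_squares f(1) g(1))
  moreover have "continuous_on {0<..} (\<lambda>t. \<bar>?n t\<bar>)"
    by (intro continuous_intros continuous_on_subset[OF f(2)] continuous_on_subset[OF g(2)]) auto
  ultimately have "\<bar>?n t\<bar> \<le> ess_norm ?n"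
    using \<open>t > 0\<close> by (intro continuous_on_AE_le_imp_le[of "{0<..}"]) auto
  then have "\<bar>?n t\<bar>^2 \<le> (ess_norm ?n)^2" by (intro power_mono) auto
  then show ?thesis by simp
qed

subsection \<open>Absolutely continuous functions\<close>

definition nonoverlapping :: "real \<Rightarrow> real \<Rightarrow> 'i set \<Rightarrow> ('i \<Rightarrow> real) \<Rightarrow> ('i \<Rightarrow> real) \<Rightarrow> bool" where
  "nonoverlapping a b I l r \<longleftrightarrow> finite I \<and> (\<forall>i\<in>I. a \<le> l i \<and> l i \<le> r i \<and> r i \<le> b) \<and>
     (\<forall>i\<in>I. \<forall>j\<in>I. i \<noteq> j \<longrightarrow> r i \<le> l j \<or> r j \<le> l i)"

lemma abs_cont_on_iff_nonoverlapping:
  "abs_cont_on a b f \<longleftrightarrow> (\<forall>e>0. \<exists>\<delta>>0. \<forall>n l r. nonoverlapping a b {..<n::nat} l r \<longrightarrow>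
     (\<Sum>i<n. r i - l i) < \<delta> \<longrightarrow> (\<Sum>i<n. \<bar>f (r i) - f (l i)\<bar>) < e)"
  unfolding abs_cont_on_def nonoverlapping_def by (simp add: Ball_def imp_conjL)

lemma abs_cont_onE:
  assumes "abs_cont_on a b f" "e > 0"
  obtains \<delta> where "\<delta> > 0" "\<And>(I::'i set) l r. nonoverlapping a b I l r \<Longrightarrow>
    (\<Sum>i\<in>I. r i - l i) < \<delta> \<Longrightarrow> (\<Sum>i\<in>I. \<bar>f (r i) - f (l i)\<bar>) < e"
proof -
  obtain \<delta> where "\<delta> > 0" and \<delta>: "\<forall>n l r. nonoverlapping a b {..<n::nat} l r \<longrightarrow>
      (\<Sum>i<n. r i - l i) < \<delta> \<longrightarrow> (\<Sum>i<n. \<bar>f (r i) - f (l i)\<bar>) < e"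
    using assms unfolding abs_cont_on_iff_nonoverlapping by blast
  have "(\<Sum>i\<in>I. \<bar>f (r i) - f (l i)\<bar>) < e"
    if I: "nonoverlapping a b I l r" and small: "(\<Sum>i\<in>I. r i - l i) < \<delta>" for I :: "'i set" and l r
  proof -
    have "finite I" using I unfolding nonoverlapping_def by blast
    then obtain h where h: "bij_betw h {..<card I} I"
      using ex_bij_betw_nat_finite[of I] unfolding lessThan_atLeast0 by blast
    have "nonoverlapping a b {..<card I} (l \<circ> h) (r \<circ> h)"
      using I bij_betw_apply[OF h] inj_onD[OF bij_betw_imp_inj_on[OF h]]
      unfolding nonoverlapping_def by (auto simp: Ball_def) metis
    moreover have "(\<Sum>i<card I. (r \<circ> h) i - (l \<circ> h) i) < \<delta>"
      using small sum.reindex_bij_betw[OF h, of "\<lambda>i. r i - l i"] by simp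
    ultimately have "(\<Sum>i<card I. \<bar>f ((r \<circ> h) i) - f ((l \<circ> h) i)\<bar>) < e"
      using \<delta> by blast
    then show ?thesis
      using sum.reindex_bij_betw[OF h, of "\<lambda>i. \<bar>f (r i) - f (l i)\<bar>"] by simp
  qed
  with \<open>\<delta> > 0\<close> show thesis by (rule that)
qed

lemma abs_cont_on_dominated:
  assumes f: "abs_cont_on a b f" and g: "abs_cont_on a b g"
    and dominated: "\<And>s t. a \<le> s \<Longrightarrow> s \<le> t \<Longrightarrow> t \<le> b \<Longrightarrow> \<bar>h t - h s\<bar> \<le> C * (\<bar>f t - f s\<bar> + \<bar>g t - g s\<bar>)"
  shows "abs_cont_on a b h"
  unfolding abs_cont_on_iff_nonoverlapping
proof (intro allI impI)
  fix e :: real assume "e > 0"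
  define M where "M = max C 1"
  have "M > 0" "C \<le> M" unfolding M_def by auto
  have "e / (2 * M) > 0" using \<open>e > 0\<close> \<open>M > 0\<close> by simp
  obtain \<delta>f where "\<delta>f > 0" and \<delta>f: "\<And>(I::nat set) l r. nonoverlapping a b I l r \<Longrightarrow>
      (\<Sum>i\<in>I. r i - l i) < \<delta>f \<Longrightarrow> (\<Sum>i\<in>I. \<bar>f (r i) - f (l i)\<bar>) < e / (2 * M)"
    using abs_cont_onE[OF f \<open>e / (2 * M) > 0\<close>] by metis
  obtain \<delta>g where "\<delta>g > 0" and \<delta>g: "\<And>(I::nat set) l r. nonoverlapping a b I l r \<Longrightarrow>
      (\<Sum>i\<in>I. r i - l i) < \<delta>g \<Longrightarrow> (\<Sum>i\<in>I. \<bar>g (r i) - g (l i)\<bar>) < e / (2 * M)"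
    using abs_cont_onE[OF g \<open>e / (2 * M) > 0\<close>] by metis
  have "(\<Sum>i<n. \<bar>h (r i) - h (l i)\<bar>) < e"
    if intervals: "nonoverlapping a b {..<n} l r"
      and small: "(\<Sum>i<n. r i - l i) < min \<delta>f \<delta>g" for n :: nat and l r
  proof -
    have "\<bar>h (r i) - h (l i)\<bar> \<le> M * (\<bar>f (r i) - f (l i)\<bar> + \<bar>g (r i) - g (l i)\<bar>)" if "i < n" for i
    proof -
      have "\<bar>h (r i) - h (l i)\<bar> \<le> C * (\<bar>f (r i) - f (l i)\<bar> + \<bar>g (r i) - g (l i)\<bar>)"
        using intervals that unfolding nonoverlapping_def by (intro dominated) auto
      also have "\<dots> \<le> M * (\<bar>f (r i) - f (l i)\<bar> + \<bar>g (r i) - g (l i)\<bar>)"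
        using \<open>C \<le> M\<close> by (intro mult_right_mono) auto
      finally show ?thesis .
    qed
    then have "(\<Sum>i<n. \<bar>h (r i) - h (l i)\<bar>) \<le> (\<Sum>i<n. M * (\<bar>f (r i) - f (l i)\<bar> + \<bar>g (r i) - g (l i)\<bar>))"
      by (intro sum_mono) auto
    also have "\<dots> = M * ((\<Sum>i<n. \<bar>f (r i) - f (l i)\<bar>) + (\<Sum>i<n. \<bar>g (r i) - g (l i)\<bar>))"
      by (simp only: sum_distrib_left[symmetric] sum.distrib)
    also have "\<dots> < M * (e / (2 * M) + e / (2 * M))"
      using small \<open>M > 0\<close> by (intro mult_strict_left_mono add_strict_mono \<delta>f \<delta>g intervals) auto
    also have "\<dots> = e" using \<open>M > 0\<close> by simp
    finally show ?thesis .
  qed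
  then show "\<exists>\<delta>>0. \<forall>n l r. nonoverlapping a b {..<n::nat} l r \<longrightarrow>
      (\<Sum>i<n. r i - l i) < \<delta> \<longrightarrow> (\<Sum>i<n. \<bar>h (r i) - h (l i)\<bar>) < e"
    using \<open>\<delta>f > 0\<close> \<open>\<delta>g > 0\<close> by (intro exI[of _ "min \<delta>f \<delta>g"]) auto
qed

lemma abs_cont_on_add:
  assumes "abs_cont_on a b f" "abs_cont_on a b g"
  shows "abs_cont_on a b (\<lambda>t. f t + g t)"
  by (rule abs_cont_on_dominated[OF assms, where C = 1]) simp

lemma abs_cont_on_cmult:
  assumes "abs_cont_on a b f"
  shows "abs_cont_on a b (\<lambda>t. k * f t)"
proof (rule abs_cont_on_dominated[OF assms assms])
  show "\<bar>k * f t - k * f s\<bar> \<le> \<bar>k\<bar> * (\<bar>f t - f s\<bar> + \<bar>f t - f s\<bar>)" for s t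
    by (simp add: right_diff_distrib[symmetric] abs_mult distrib_left)
qed

lemma abs_cont_on_mult:
  assumes f: "abs_cont_on a b f" "continuous_on {a..b} f"
    and g: "abs_cont_on a b g" "continuous_on {a..b} g"
  shows "abs_cont_on a b (\<lambda>t. f t * g t)"
proof -
  have "bounded (f ` {a..b})" "bounded (g ` {a..b})"
    using f(2) g(2) by (auto intro: compact_imp_bounded compact_continuous_image)
  then obtain F G where F: "\<And>t. t \<in> {a..b} \<Longrightarrow> \<bar>f t\<bar> \<le> F" and G: "\<And>t. t \<in> {a..b} \<Longrightarrow> \<bar>g t\<bar> \<le> G"
    unfolding bounded_iff by (metis imageI real_norm_def)
  show ?thesis
  proof (rule abs_cont_on_dominated[OF f(1) g(1)])
    fix s t assume ordered: "a \<le> s" "s \<le> t" "t \<le> b"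
    then have "F \<ge> 0" "G \<ge> 0" using F[of s] G[of s] by auto
    have "\<bar>f t * g t - f s * g s\<bar> = \<bar>g t * (f t - f s) + f s * (g t - g s)\<bar>"
      by (simp add: algebra_simps)
    also have "\<dots> \<le> \<bar>g t\<bar> * \<bar>f t - f s\<bar> + \<bar>f s\<bar> * \<bar>g t - g s\<bar>"
      by (metis abs_mult abs_triangle_ineq)
    also have "\<dots> \<le> (F + G) * \<bar>f t - f s\<bar> + (F + G) * \<bar>g t - g s\<bar>"
      using F[of s] G[of t] ordered \<open>F \<ge> 0\<close> \<open>G \<ge> 0\<close> by (intro add_mono mult_right_mono) auto
    finally show "\<bar>f t * g t - f s * g s\<bar> \<le> (F + G) * (\<bar>f t - f s\<bar> + \<bar>g t - g s\<bar>)"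
      by (simp add: distrib_left)
  qed
qed

lemma lipschitz_on_imp_abs_cont_on:
  assumes "C-lipschitz_on {a..b} f"
  shows "abs_cont_on a b f"
proof (rule abs_cont_on_dominated)
  show "abs_cont_on a b (\<lambda>t. t)"
    unfolding abs_cont_on_iff_nonoverlapping by (auto simp: nonoverlapping_def)
  then show "abs_cont_on a b (\<lambda>t. t)" .
  show "\<bar>f t - f s\<bar> \<le> C * (\<bar>t - s\<bar> + \<bar>t - s\<bar>)" if "a \<le> s" "s \<le> t" "t \<le> b" for s t
  proof -
    have "\<bar>f t - f s\<bar> \<le> C * \<bar>t - s\<bar>"
      using lipschitz_onD[OF assms, of t s] that by (simp add: dist_real_def)
    moreover have "0 \<le> C * \<bar>t - s\<bar>"
      using lipschitz_on_nonneg[OF assms] by simp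
    ultimately show ?thesis by (simp add: distrib_left)
  qed
qed

lemma C1_imp_abs_cont_on:
  assumes deriv: "\<And>t. t \<in> {a..b} \<Longrightarrow> (f has_real_derivative f' t) (at t within {a..b})"
    and cont: "continuous_on {a..b} f'"
  shows "abs_cont_on a b f"
proof -
  have "bounded (f' ` {a..b})"
    using cont by (auto intro: compact_imp_bounded compact_continuous_image)
  then obtain C where "C > 0" and C: "\<And>t. t \<in> {a..b} \<Longrightarrow> \<bar>f' t\<bar> \<le> C"
    unfolding bounded_pos by auto
  have "C-lipschitz_on {a..b} f"
  proof (rule bounded_derivative_imp_lipschitz)
    show "(f has_derivative (*) (f' t)) (at t within {a..b})" if "t \<in> {a..b}" for t
      using deriv[OF that] unfolding has_field_derivative_def .
    show "onorm ((*) (f' t)) \<le> C" if "t \<in> {a..b}" for t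
      using C[OF that] by (intro onorm_bound) (auto simp: abs_mult mult_right_mono \<open>C > 0\<close> less_imp_le)
  qed (use \<open>C > 0\<close> in auto)
  then show ?thesis by (rule lipschitz_on_imp_abs_cont_on)
qed

lemma has_real_derivative_straddle:
  assumes "(f has_real_derivative D) (at t)" "e > 0"
  obtains d where "d > 0"
    "\<And>l r. l \<le> t \<Longrightarrow> t \<le> r \<Longrightarrow> {l..r} \<subseteq> ball t d \<Longrightarrow> \<bar>f r - f l - D * (r - l)\<bar> \<le> e * (r - l)"
proof -
  have "(f has_derivative (\<lambda>h. D * h)) (at t)"
    using assms(1) by (simp add: has_field_derivative_def)
  then obtain d where "d > 0" and
    d: "\<And>s. norm (s - t) < d \<Longrightarrow> norm (f s - f t - D * (s - t)) \<le> e * norm (s - t)"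
    using \<open>e > 0\<close> unfolding has_derivative_at_alt by blast
  have "\<bar>f r - f l - D * (r - l)\<bar> \<le> e * (r - l)"
    if straddles: "l \<le> t" "t \<le> r" "{l..r} \<subseteq> ball t d" for l r
  proof -
    have "l \<in> ball t d" "r \<in> ball t d"
      using straddles by (auto intro!: subsetD[OF straddles(3)] simp del: mem_ball)
    then have "\<bar>f r - f t - D * (r - t)\<bar> \<le> e * (r - t)" "\<bar>f l - f t - D * (l - t)\<bar> \<le> e * (t - l)"
      using d[of r] d[of l] straddles(1,2) by (auto simp: dist_real_def)
    moreover have "f r - f l - D * (r - l) = (f r - f t - D * (r - t)) - (f l - f t - D * (l - t))"
      "e * (r - l) = e * (r - t) + e * (t - l)"
      by (simp_all add: algebra_simps)
    ultimately show ?thesis by linarith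
  qed
  with \<open>d > 0\<close> show thesis by (rule that)
qed

lemma nonoverlapping_sum_length_le_measure:
  assumes intervals: "nonoverlapping a b I l r" and sub: "\<And>i. i \<in> I \<Longrightarrow> {l i..r i} \<subseteq> U"
    and U: "U \<in> lmeasurable"
  shows "(\<Sum>i\<in>I. r i - l i) \<le> measure lebesgue U"
proof -
  have "finite I" and ordered: "\<And>i. i \<in> I \<Longrightarrow> l i \<le> r i"
    and "\<And>i j. i \<in> I \<Longrightarrow> j \<in> I \<Longrightarrow> i \<noteq> j \<Longrightarrow> r i \<le> l j \<or> r j \<le> l i"
    using intervals unfolding nonoverlapping_def by blast+
  then have disjoint: "pairwise (\<lambda>i j. disjnt {l i<..<r i} {l j<..<r j}) I"
    unfolding pairwise_def disjnt_def by (metis Int_greaterThanLessThan greaterThanLessThan_empty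
        max.coboundedI1 max.coboundedI2 min.coboundedI1 min.coboundedI2)
  have "(\<Sum>i\<in>I. r i - l i) = (\<Sum>i\<in>I. measure lebesgue {l i<..<r i})"
    by (intro sum.cong) (auto simp: measure_completion ordered)
  also have "\<dots> = measure lebesgue (\<Union>i\<in>I. {l i<..<r i})"
    using disjoint \<open>finite I\<close> by (intro measure_UNION'[symmetric]) auto
  also have "\<dots> \<le> measure lebesgue U"
  proof (rule measure_mono_fmeasurable)
    show "(\<Union>i\<in>I. {l i<..<r i}) \<subseteq> U" using sub by force
  qed (use U \<open>finite I\<close> in auto)
  finally show ?thesis .
qed

lemma tagged_division_of_realD:
  assumes "P tagged_division_of {a..b::real}" "(x, K) \<in> P"
  shows "{Inf K..Sup K} = K" "Inf K \<le> x" "x \<le> Sup K" "a \<le> Inf K" "Sup K \<le> b"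
proof -
  obtain l r where K: "K = {l..r}"
    using tagged_division_ofD(4)[OF assms] by auto
  moreover have "x \<in> K" "K \<subseteq> {a..b}"
    using tagged_division_ofD(2,3)[OF assms] by auto
  ultimately show "{Inf K..Sup K} = K" "Inf K \<le> x" "x \<le> Sup K" "a \<le> Inf K" "Sup K \<le> b"
    by auto
qed

lemma tagged_division_nonoverlapping:
  assumes P: "P tagged_division_of {a..b::real}" and "Q \<subseteq> P"
    and nondegenerate: "\<And>x K. (x, K) \<in> Q \<Longrightarrow> Inf K < Sup K"
  shows "nonoverlapping a b Q (Inf \<circ> snd) (Sup \<circ> snd)"
proof -
  have "Sup K \<le> Inf K' \<or> Sup K' \<le> Inf K"
    if Q: "(x, K) \<in> Q" "(x', K') \<in> Q" and distinct: "(x, K) \<noteq> (x', K')" for x K x' K'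
  proof (rule ccontr)
    have tagged: "(x, K) \<in> P" "(x', K') \<in> P" using Q \<open>Q \<subseteq> P\<close> by auto
    assume "\<not> ?thesis"
    then have "max (Inf K) (Inf K') < min (Sup K) (Sup K')"
      using nondegenerate[OF Q(1)] nondegenerate[OF Q(2)] by auto
    then obtain m where "max (Inf K) (Inf K') < m" "m < min (Sup K) (Sup K')"
      using dense by blast
    then have "m \<in> interior {Inf K..Sup K} \<inter> interior {Inf K'..Sup K'}"
      by (simp add: interior_atLeastAtMost_real)
    then show False
      using tagged_division_ofD(5)[OF P tagged distinct] tagged_division_of_realD(1)[OF P tagged(1)]
        tagged_division_of_realD(1)[OF P tagged(2)] by auto
  qed
  moreover have "finite Q"
    using tagged_division_ofD(1)[OF P] \<open>Q \<subseteq> P\<close> finite_subset by blast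
  moreover have "a \<le> Inf K \<and> Inf K \<le> Sup K \<and> Sup K \<le> b" if "(x, K) \<in> Q" for x K
    using tagged_division_of_realD[OF P, of x K] \<open>Q \<subseteq> P\<close> that by auto
  ultimately show ?thesis
    unfolding nonoverlapping_def by fastforce
qed

text \<open>Cousin's lemma provides a tagged division that is fine for the gauge given by \<open>U\<close> on \<open>N\<close>
  and by the straddle property off \<open>N\<close>.\<close>

lemma tagged_division_nonpos_derivative:
  assumes "e > 0" and U: "open U" "N \<subseteq> U"
    and deriv: "\<And>t. t \<in> {a..b} - N \<Longrightarrow> \<exists>D\<le>0. (f has_real_derivative D) (at t)"
  obtains P where "P tagged_division_of {a..b}"
    "\<And>x K. (x, K) \<in> P \<Longrightarrow> x \<in> N \<Longrightarrow> K \<subseteq> U"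
    "\<And>x K. (x, K) \<in> P \<Longrightarrow> x \<notin> N \<Longrightarrow> f (Sup K) - f (Inf K) \<le> e * (Sup K - Inf K)"
proof -
  have "\<exists>d>0. \<forall>l r. l \<le> t \<longrightarrow> t \<le> r \<longrightarrow> {l..r} \<subseteq> ball t d \<longrightarrow> f r - f l \<le> e * (r - l)"
    if t: "t \<in> {a..b} - N" for t
  proof -
    obtain D where "D \<le> 0" and D: "(f has_real_derivative D) (at t)" using deriv[OF t] by blast
    obtain d where "d > 0" and
      d: "\<And>l r. l \<le> t \<Longrightarrow> t \<le> r \<Longrightarrow> {l..r} \<subseteq> ball t d \<Longrightarrow> \<bar>f r - f l - D * (r - l)\<bar> \<le> e * (r - l)"
      using has_real_derivative_straddle[OF D \<open>e > 0\<close>] by metis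
    have "f r - f l \<le> e * (r - l)" if "l \<le> t" "t \<le> r" "{l..r} \<subseteq> ball t d" for l r
      using d[OF that] mult_nonpos_nonneg[OF \<open>D \<le> 0\<close>, of "r - l"] that by linarith
    with \<open>d > 0\<close> show ?thesis by blast
  qed
  then have "\<forall>t\<in>{a..b} - N. \<exists>d>0. \<forall>l r. l \<le> t \<longrightarrow> t \<le> r \<longrightarrow> {l..r} \<subseteq> ball t d \<longrightarrow>
      f r - f l \<le> e * (r - l)"
    by blast
  from bchoice[OF this] obtain d where d: "\<forall>t\<in>{a..b} - N. 0 < d t \<and>
      (\<forall>l r. l \<le> t \<longrightarrow> t \<le> r \<longrightarrow> {l..r} \<subseteq> ball t (d t) \<longrightarrow> f r - f l \<le> e * (r - l))" ..
  define \<gamma> where "\<gamma> t = (if t \<in> N then U else if t \<in> {a..b} then ball t (d t) else UNIV)" for t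
  have "gauge \<gamma>"
    unfolding gauge_def \<gamma>_def using U d by auto
  then obtain P where P: "P tagged_division_of {a..b}" and fine: "\<gamma> fine P"
    using fine_division_exists_real by blast
  show thesis
  proof (rule that[OF P])
    fix x K assume tagged: "(x, K) \<in> P"
    have K: "K \<subseteq> \<gamma> x" using fine tagged unfolding fine_def by blast
    show "K \<subseteq> U" if "x \<in> N"
      using K that unfolding \<gamma>_def by simp
    show "f (Sup K) - f (Inf K) \<le> e * (Sup K - Inf K)" if "x \<notin> N"
    proof -
      note K_bounds = tagged_division_of_realD[OF P tagged]
      have "x \<in> {a..b} - N" using K_bounds that by auto
      moreover from this have "{Inf K..Sup K} \<subseteq> ball x (d x)"
        unfolding K_bounds(1) using K by (simp add: \<gamma>_def)
      ultimately show ?thesis using d K_bounds(2,3) by blast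
    qed
  qed
qed

lemma abs_cont_on_sum_tagged_division_less:
  assumes ac: "abs_cont_on a b f" and "e > 0"
  obtains \<delta> where "\<delta> > 0"
    "\<forall>P Q U. P tagged_division_of {a..b} \<longrightarrow> Q \<subseteq> P \<longrightarrow> U \<in> lmeasurable \<longrightarrow>
      measure lebesgue U < \<delta> \<longrightarrow> (\<forall>(x, K)\<in>Q. Inf K < Sup K \<and> K \<subseteq> U) \<longrightarrow>
      (\<Sum>xK\<in>Q. \<bar>f (Sup (snd xK)) - f (Inf (snd xK))\<bar>) < e"
proof -
  obtain \<delta> where "\<delta> > 0" and \<delta>: "\<And>(I::(real \<times> real set) set) l r. nonoverlapping a b I l r \<Longrightarrow>
      (\<Sum>i\<in>I. r i - l i) < \<delta> \<Longrightarrow> (\<Sum>i\<in>I. \<bar>f (r i) - f (l i)\<bar>) < e"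
    using abs_cont_onE[OF ac \<open>e > 0\<close>] by metis
  have "(\<Sum>xK\<in>Q. \<bar>f (Sup (snd xK)) - f (Inf (snd xK))\<bar>) < e"
    if P: "P tagged_division_of {a..b}" and "Q \<subseteq> P" and U: "U \<in> lmeasurable" "measure lebesgue U < \<delta>"
      and Q: "\<forall>(x, K)\<in>Q. Inf K < Sup K \<and> K \<subseteq> U" for P Q U
  proof -
    have intervals: "nonoverlapping a b Q (Inf \<circ> snd) (Sup \<circ> snd)"
      using Q by (intro tagged_division_nonoverlapping[OF P \<open>Q \<subseteq> P\<close>]) blast
    have "(\<Sum>xK\<in>Q. (Sup \<circ> snd) xK - (Inf \<circ> snd) xK) \<le> measure lebesgue U"
    proof (rule nonoverlapping_sum_length_le_measure[OF intervals _ U(1)])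
      show "{(Inf \<circ> snd) xK..(Sup \<circ> snd) xK} \<subseteq> U" if "xK \<in> Q" for xK
        using that Q \<open>Q \<subseteq> P\<close> tagged_division_of_realD(1)[OF P] by (cases xK) fastforce
    qed
    with U(2) have "(\<Sum>xK\<in>Q. \<bar>f ((Sup \<circ> snd) xK) - f ((Inf \<circ> snd) xK)\<bar>) < e"
      by (intro \<delta>[OF intervals]) simp
    then show ?thesis by simp
  qed
  with \<open>\<delta> > 0\<close> show thesis by (intro that) blast+
qed

lemma increment_le_tagged_division:
  fixes f :: "real \<Rightarrow> real"
  assumes P: "P tagged_division_of {a..b}" and "a \<le> b" and "Q \<subseteq> P" and "e \<ge> 0"
    and controlled: "\<And>x K. (x, K) \<in> P - Q \<Longrightarrow> f (Sup K) - f (Inf K) \<le> e * (Sup K - Inf K)"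
    and exceptional: "(\<Sum>xK\<in>Q. \<bar>f (Sup (snd xK)) - f (Inf (snd xK))\<bar>) \<le> \<eta>"
  shows "f b - f a \<le> e * (b - a) + \<eta>"
proof -
  have "finite P" by (rule tagged_division_ofD(1)[OF P])
  let ?inc = "\<lambda>xK. f (Sup (snd xK)) - f (Inf (snd xK))"
  let ?len = "\<lambda>xK. Sup (snd xK) - Inf (snd xK) :: real"
  have "f b - f a = (\<Sum>xK\<in>P. ?inc xK)"
    using additive_tagged_division_1[OF \<open>a \<le> b\<close> P, of f] by (simp add: case_prod_beta')
  also have "\<dots> = (\<Sum>xK\<in>P - Q. ?inc xK) + (\<Sum>xK\<in>Q. ?inc xK)"
    by (rule sum.subset_diff) fact+
  also have "(\<Sum>xK\<in>P - Q. ?inc xK) \<le> (\<Sum>xK\<in>P - Q. e * ?len xK)"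
    using controlled by (intro sum_mono) force
  also have "\<dots> \<le> (\<Sum>xK\<in>P. e * ?len xK)"
    using \<open>finite P\<close> \<open>e \<ge> 0\<close> tagged_division_of_realD(2,3)[OF P]
    by (intro sum_mono2) (force intro: order_trans)+
  also have "\<dots> = e * (b - a)"
    using additive_tagged_division_1[OF \<open>a \<le> b\<close> P, of "\<lambda>t. t"]
    by (simp add: sum_distrib_left[symmetric] case_prod_beta')
  also have "(\<Sum>xK\<in>Q. ?inc xK) \<le> \<eta>"
    using exceptional by (rule order_trans[OF sum_mono, rotated]) simp
  finally show ?thesis by simp
qed

lemma abs_cont_on_nonincreasing:
  assumes ac: "abs_cont_on a b f" and "a \<le> b"
    and deriv: "AE t in lebesgue_on {a..b}. \<exists>D\<le>0. (f has_real_derivative D) (at t)"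
  shows "f b \<le> f a"
proof (rule field_le_epsilon)
  fix \<eta> :: real assume "\<eta> > 0"
  define e where "e = \<eta> / (1 + (b - a))"
  have "e > 0" using \<open>\<eta> > 0\<close> \<open>a \<le> b\<close> unfolding e_def by simp
  define N where "N = {t \<in> {a..b}. \<not> (\<exists>D\<le>0. (f has_real_derivative D) (at t))}"
  have "negligible N"
    using deriv AE_lebesgue_on_iff_negligible[of "{a..b}"] unfolding N_def by simp
  obtain \<delta> where "\<delta> > 0" and \<delta>: "\<forall>P Q U. P tagged_division_of {a..b} \<longrightarrow> Q \<subseteq> P \<longrightarrow>
      U \<in> lmeasurable \<longrightarrow> measure lebesgue U < \<delta> \<longrightarrow>
      (\<forall>(x, K)\<in>Q. Inf K < Sup K \<and> K \<subseteq> U) \<longrightarrow>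
      (\<Sum>xK\<in>Q. \<bar>f (Sup (snd xK)) - f (Inf (snd xK))\<bar>) < e"
    using abs_cont_on_sum_tagged_division_less[OF ac \<open>e > 0\<close>] .
  obtain U where U: "open U" "N \<subseteq> U" "U \<in> lmeasurable" "measure lebesgue U < \<delta>"
    using negligible_outer_open[OF \<open>negligible N\<close> \<open>\<delta> > 0\<close>] .
  have "\<exists>D\<le>0. (f has_real_derivative D) (at t)" if "t \<in> {a..b} - N" for t
    using that unfolding N_def by blast
  then obtain P where P: "P tagged_division_of {a..b}"
    and in_N: "\<And>x K. (x, K) \<in> P \<Longrightarrow> x \<in> N \<Longrightarrow> K \<subseteq> U"
    and off_N: "\<And>x K. (x, K) \<in> P \<Longrightarrow> x \<notin> N \<Longrightarrow> f (Sup K) - f (Inf K) \<le> e * (Sup K - Inf K)"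
    using tagged_division_nonpos_derivative[OF \<open>e > 0\<close> U(1,2)] by metis
  define Q where "Q = {(x, K) \<in> P. x \<in> N \<and> Inf K < Sup K}"
  have "Q \<subseteq> P" unfolding Q_def by auto
  then have "(\<Sum>xK\<in>Q. \<bar>f (Sup (snd xK)) - f (Inf (snd xK))\<bar>) < e"
    by (intro \<delta>[rule_format, OF P _ U(3,4)]) (use in_N in \<open>auto simp: Q_def\<close>)
  moreover have "f (Sup K) - f (Inf K) \<le> e * (Sup K - Inf K)" if "(x, K) \<in> P - Q" for x K
  proof (cases "x \<in> N")
    case True
    then have "Inf K = Sup K"
      using that tagged_division_of_realD(2,3)[OF P, of x K] unfolding Q_def by fastforce
    then show ?thesis by simp
  next
    case False
    then show ?thesis using off_N that by blast
  qed
  ultimately have "f b - f a \<le> e * (b - a) + e"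
    using increment_le_tagged_division[OF P \<open>a \<le> b\<close> \<open>Q \<subseteq> P\<close>, of e f e] \<open>e > 0\<close> by simp
  also have "\<dots> = e * (1 + (b - a))" by (simp add: algebra_simps)
  also have "\<dots> = \<eta>" using \<open>a \<le> b\<close> unfolding e_def by simp
  finally show "f b \<le> f a + \<eta>" by simp
qed

subsection \<open>Limits superior and bounded monotone functions\<close>

lemma Limsup_ereal_le_iff:
  "Limsup F (\<lambda>x. ereal (f x)) \<le> ereal C \<longleftrightarrow> (\<forall>B>C. \<forall>\<^sub>F x in F. f x < B)"
proof
  assume "Limsup F (\<lambda>x. ereal (f x)) \<le> ereal C"
  then have "\<forall>\<^sub>F x in F. ereal (f x) < ereal B" if "C < B" for B
    using that unfolding Limsup_le_iff by (metis less_ereal.simps(1))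
  then show "\<forall>B>C. \<forall>\<^sub>F x in F. f x < B" by simp
next
  assume eventually_less: "\<forall>B>C. \<forall>\<^sub>F x in F. f x < B"
  show "Limsup F (\<lambda>x. ereal (f x)) \<le> ereal C"
    unfolding Limsup_le_iff
  proof (intro allI impI)
    fix B assume "ereal C < B"
    then show "\<forall>\<^sub>F x in F. ereal (f x) < B"
      using eventually_less by (cases B) auto
  qed
qed

lemma Limsup_mult_le:
  fixes f g :: "'a \<Rightarrow> real"
  assumes f: "\<And>x. 0 \<le> f x" "Limsup F (\<lambda>x. ereal (f x)) \<le> ereal A" and "0 \<le> A"
    and g: "\<And>x. 0 \<le> g x" "Limsup F (\<lambda>x. ereal (g x)) \<le> ereal B" and "0 \<le> B"
  shows "Limsup F (\<lambda>x. ereal (f x * g x)) \<le> ereal (A * B)"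
  unfolding Limsup_ereal_le_iff
proof (intro allI impI)
  fix C assume "A * B < C"
  have "((\<lambda>\<delta>. (A + \<delta>) * (B + \<delta>)) \<longlongrightarrow> (A + 0) * (B + 0)) (at_right 0)"
    by (intro tendsto_intros)
  then have "\<forall>\<^sub>F \<delta> in at_right 0. (A + \<delta>) * (B + \<delta>) < C"
    using \<open>A * B < C\<close> by (intro order_tendstoD) auto
  moreover have "\<forall>\<^sub>F \<delta> in at_right 0. 0 < (\<delta>::real)"
    by (rule eventually_at_right_less)
  ultimately have "\<exists>\<delta>. (A + \<delta>) * (B + \<delta>) < C \<and> 0 < \<delta>"
    by (intro eventually_happens'[OF trivial_limit_at_right_real] eventually_conj)
  then obtain \<delta> where \<delta>: "(A + \<delta>) * (B + \<delta>) < C" "0 < \<delta>" by blast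
  have "\<forall>\<^sub>F x in F. f x < A + \<delta>" "\<forall>\<^sub>F x in F. g x < B + \<delta>"
    using f(2) g(2) \<delta>(2) unfolding Limsup_ereal_le_iff by simp_all
  then show "\<forall>\<^sub>F x in F. f x * g x < C"
  proof eventually_elim
    case (elim x)
    have "f x * g x \<le> (A + \<delta>) * (B + \<delta>)"
      using elim f(1) g(1) \<delta>(2) \<open>0 \<le> A\<close> by (intro mult_mono) auto
    with \<delta>(1) show ?case by simp
  qed
qed

lemma Limsup_ereal_real:
  fixes f :: "'a \<Rightarrow> real"
  assumes "F \<noteq> bot" "\<forall>\<^sub>F x in F. 0 \<le> f x" "\<forall>\<^sub>F x in F. f x \<le> M"
  obtains A where "Limsup F (\<lambda>x. ereal (f x)) = ereal A" "0 \<le> A"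
proof -
  have "0 \<le> Limsup F (\<lambda>x. ereal (f x))"
    using assms(1,2) by (intro le_Limsup) auto
  moreover have "Limsup F (\<lambda>x. ereal (f x)) \<le> ereal M"
    using assms(3) by (intro Limsup_bounded) auto
  ultimately show thesis
    using that by (cases "Limsup F (\<lambda>x. ereal (f x))") auto
qed

lemma mono_bounded_small_increments:
  fixes g :: "real \<Rightarrow> real"
  assumes mono: "mono_on {T..} g" and bdd: "bdd_above (g ` {T..})" and "\<delta> > 0"
  obtains t\<^sub>0 where "t\<^sub>0 \<ge> T" "\<And>s t. t\<^sub>0 \<le> s \<Longrightarrow> t\<^sub>0 \<le> t \<Longrightarrow> g t < g s + \<delta>"
proof -
  obtain t\<^sub>0 where "T \<le> t\<^sub>0" and t\<^sub>0: "Sup (g ` {T..}) - \<delta> < g t\<^sub>0"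
    using less_cSup_iff[OF _ bdd, of "Sup (g ` {T..}) - \<delta>"] \<open>\<delta> > 0\<close> by auto
  have "g t < g s + \<delta>" if "t\<^sub>0 \<le> s" "t\<^sub>0 \<le> t" for s t
  proof -
    have "g t \<le> Sup (g ` {T..})" using that \<open>T \<le> t\<^sub>0\<close> by (intro cSup_upper bdd) auto
    moreover have "g t\<^sub>0 \<le> g s" using that \<open>T \<le> t\<^sub>0\<close> by (intro mono_onD[OF mono]) auto
    ultimately show ?thesis using t\<^sub>0 by linarith
  qed
  with \<open>T \<le> t\<^sub>0\<close> show thesis by (rule that)
qed

subsection \<open>Differential inequalities\<close>

definition ac_deriv_le :: "real \<Rightarrow> (real \<Rightarrow> real) \<Rightarrow> (real \<Rightarrow> real) \<Rightarrow> bool" where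
  "ac_deriv_le T f \<phi> \<longleftrightarrow> continuous_on {T..} f \<and> (\<forall>s r. T < s \<longrightarrow> s \<le> r \<longrightarrow> abs_cont_on s r f) \<and>
     (AE t in lebesgue_on {T<..}. \<exists>D\<le>\<phi> t. (f has_real_derivative D) (at t))"

lemma ac_deriv_leI:
  assumes "continuous_on {T..} f" "\<And>s r. T < s \<Longrightarrow> s \<le> r \<Longrightarrow> abs_cont_on s r f"
    and "AE t in lebesgue_on {T<..}. \<exists>D\<le>\<phi> t. (f has_real_derivative D) (at t)"
  shows "ac_deriv_le T f \<phi>"
  using assms unfolding ac_deriv_le_def by blast

lemma ac_deriv_leD:
  assumes "ac_deriv_le T f \<phi>"
  shows "continuous_on {T..} f" "\<And>s r. T < s \<Longrightarrow> s \<le> r \<Longrightarrow> abs_cont_on s r f"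
    and "AE t in lebesgue_on {T<..}. \<exists>D\<le>\<phi> t. (f has_real_derivative D) (at t)"
  using assms unfolding ac_deriv_le_def by blast+

lemma ac_deriv_le_mono:
  assumes f: "ac_deriv_le S f \<phi>" and "S \<le> T" and rhs_le: "AE t in lebesgue_on {T<..}. \<phi> t \<le> \<psi> t"
  shows "ac_deriv_le T f \<psi>"
proof (rule ac_deriv_leI)
  show "continuous_on {T..} f"
    using \<open>S \<le> T\<close> by (intro continuous_on_subset[OF ac_deriv_leD(1)[OF f]]) auto
  show "abs_cont_on s r f" if "T < s" "s \<le> r" for s r
    using \<open>S \<le> T\<close> that by (intro ac_deriv_leD(2)[OF f]) auto
  have "AE t in lebesgue_on {T<..}. \<exists>D\<le>\<phi> t. (f has_real_derivative D) (at t)"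
    using \<open>S \<le> T\<close> by (intro AE_lebesgue_on_subset[OF ac_deriv_leD(3)[OF f]]) auto
  then show "AE t in lebesgue_on {T<..}. \<exists>D\<le>\<psi> t. (f has_real_derivative D) (at t)"
    using rhs_le
  proof eventually_elim
    case (elim t)
    then obtain D where "D \<le> \<phi> t" "(f has_real_derivative D) (at t)" by blast
    then show ?case using \<open>\<phi> t \<le> \<psi> t\<close> by (intro exI[of _ D]) auto
  qed
qed

lemma ac_deriv_le_add:
  assumes f: "ac_deriv_le T f \<phi>" and g: "ac_deriv_le T g \<psi>"
  shows "ac_deriv_le T (\<lambda>t. f t + g t) (\<lambda>t. \<phi> t + \<psi> t)"
proof (rule ac_deriv_leI)
  show "continuous_on {T..} (\<lambda>t. f t + g t)"
    by (intro continuous_on_add ac_deriv_leD(1)[OF f] ac_deriv_leD(1)[OF g])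
  show "abs_cont_on s r (\<lambda>t. f t + g t)" if "T < s" "s \<le> r" for s r
    by (intro abs_cont_on_add ac_deriv_leD(2)[OF f] ac_deriv_leD(2)[OF g] that)
  show "AE t in lebesgue_on {T<..}. \<exists>D\<le>\<phi> t + \<psi> t. ((\<lambda>t. f t + g t) has_real_derivative D) (at t)"
    using ac_deriv_leD(3)[OF f] ac_deriv_leD(3)[OF g]
  proof eventually_elim
    case (elim t)
    then obtain D E where "D \<le> \<phi> t" "(f has_real_derivative D) (at t)"
      "E \<le> \<psi> t" "(g has_real_derivative E) (at t)"
      by blast
    then show ?case by (intro exI[of _ "D + E"] conjI add_mono DERIV_add)
  qed
qed

lemma ac_deriv_le_cmult:
  assumes f: "ac_deriv_le T f \<phi>" and "k \<ge> 0"
  shows "ac_deriv_le T (\<lambda>t. k * f t) (\<lambda>t. k * \<phi> t)"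
proof (rule ac_deriv_leI)
  show "continuous_on {T..} (\<lambda>t. k * f t)"
    by (intro continuous_intros ac_deriv_leD(1)[OF f])
  show "abs_cont_on s r (\<lambda>t. k * f t)" if "T < s" "s \<le> r" for s r
    by (intro abs_cont_on_cmult ac_deriv_leD(2)[OF f] that)
  show "AE t in lebesgue_on {T<..}. \<exists>D\<le>k * \<phi> t. ((\<lambda>t. k * f t) has_real_derivative D) (at t)"
    using ac_deriv_leD(3)[OF f]
  proof eventually_elim
    case (elim t)
    then obtain D where "D \<le> \<phi> t" "(f has_real_derivative D) (at t)" by blast
    then show ?case using \<open>k \<ge> 0\<close> by (intro exI[of _ "k * D"] conjI mult_left_mono DERIV_cmult)
  qed
qed

lemma C1_imp_ac_deriv_le:
  assumes cont: "continuous_on {T..} f" and cont': "continuous_on {T<..} f'"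
    and deriv: "\<And>t. T < t \<Longrightarrow> (f has_real_derivative f' t) (at t)"
  shows "ac_deriv_le T f f'"
proof (rule ac_deriv_leI)
  show "abs_cont_on s r f" if "T < s" for s r
  proof (rule C1_imp_abs_cont_on)
    show "continuous_on {s..r} f'" using that by (intro continuous_on_subset[OF cont']) auto
    show "(f has_real_derivative f' t) (at t within {s..r})" if "t \<in> {s..r}" for t
      using \<open>T < s\<close> that by (intro has_field_derivative_at_within[OF deriv]) auto
  qed
  show "AE t in lebesgue_on {T<..}. \<exists>D\<le>f' t. (f has_real_derivative D) (at t)"
    by (intro AE_lebesgue_on_greaterThanI exI conjI) (rule order_refl, erule deriv)
qed fact

lemma ac_deriv_le_exp_mult:
  assumes f: "ac_deriv_le T f \<phi>"
  shows "ac_deriv_le T (\<lambda>t. exp (k * t) * f t) (\<lambda>t. exp (k * t) * (\<phi> t + k * f t))"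
proof (rule ac_deriv_leI)
  have exp_deriv: "((\<lambda>t. exp (k * t)) has_real_derivative k * exp (k * t)) (at t)" for t
    by (auto intro!: derivative_eq_intros)
  show "continuous_on {T..} (\<lambda>t. exp (k * t) * f t)"
    by (intro continuous_intros ac_deriv_leD(1)[OF f])
  show "abs_cont_on s r (\<lambda>t. exp (k * t) * f t)" if "T < s" "s \<le> r" for s r
  proof (rule abs_cont_on_mult)
    show "abs_cont_on s r (\<lambda>t. exp (k * t))"
      by (rule C1_imp_abs_cont_on[OF has_field_derivative_at_within[OF exp_deriv]])
        (intro continuous_intros)
    show "continuous_on {s..r} f"
      using \<open>T < s\<close> by (intro continuous_on_subset[OF ac_deriv_leD(1)[OF f]]) auto
  qed (intro continuous_intros ac_deriv_leD(2)[OF f] that)+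
  show "AE t in lebesgue_on {T<..}. \<exists>D\<le>exp (k * t) * (\<phi> t + k * f t).
      ((\<lambda>t. exp (k * t) * f t) has_real_derivative D) (at t)"
    using ac_deriv_leD(3)[OF f]
  proof eventually_elim
    case (elim t)
    then obtain D where "D \<le> \<phi> t" and D: "(f has_real_derivative D) (at t)" by blast
    have "((\<lambda>t. exp (k * t) * f t) has_real_derivative exp (k * t) * (D + k * f t)) (at t)"
      using DERIV_mult[OF exp_deriv[of t] D] by (simp add: algebra_simps)
    moreover have "exp (k * t) * (D + k * f t) \<le> exp (k * t) * (\<phi> t + k * f t)"
      using \<open>D \<le> \<phi> t\<close> by simp
    ultimately show ?case by blast
  qed
qed

lemma ac_deriv_le_square:
  assumes cont: "continuous_on {T..} f" and ac: "\<And>s r. T < s \<Longrightarrow> s \<le> r \<Longrightarrow> abs_cont_on s r f"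
    and deriv: "AE t in lebesgue_on {T<..}. (f has_real_derivative f' t) (at t)"
  shows "ac_deriv_le T (\<lambda>t. (f t)^2) (\<lambda>t. 2 * (f t * f' t))"
proof (rule ac_deriv_leI)
  show "continuous_on {T..} (\<lambda>t. (f t)^2)"
    by (intro continuous_intros cont)
  show "abs_cont_on s r (\<lambda>t. (f t)^2)" if "T < s" "s \<le> r" for s r
    unfolding power2_eq_square using that
    by (intro abs_cont_on_mult ac continuous_on_subset[OF cont]) auto
  show "AE t in lebesgue_on {T<..}. \<exists>D\<le>2 * (f t * f' t). ((\<lambda>t. (f t)^2) has_real_derivative D) (at t)"
    using deriv
  proof eventually_elim
    case (elim t)
    then have "((\<lambda>t. (f t)^2) has_real_derivative 2 * (f t * f' t)) (at t)"
      by (auto intro!: derivative_eq_intros)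
    then show ?case by blast
  qed
qed

lemma ac_deriv_le_nonincreasing:
  assumes f: "ac_deriv_le T f (\<lambda>_. 0)" and "T \<le> s" "s \<le> t"
  shows "f t \<le> f s"
proof -
  have decreasing: "f t \<le> f r" if r: "T < r" "r \<le> t" for r
  proof (rule abs_cont_on_nonincreasing[where f = f])
    show "abs_cont_on r t f" by (rule ac_deriv_leD(2)[OF f r])
    show "AE u in lebesgue_on {r..t}. \<exists>D\<le>0. (f has_real_derivative D) (at u)"
      using \<open>T < r\<close> by (intro AE_lebesgue_on_subset[OF ac_deriv_leD(3)[OF f]]) auto
  qed fact
  show ?thesis
  proof (cases "T < s \<or> s = t")
    case False
    then have "s < t" "s = T" using assms by auto
    have "(f \<longlongrightarrow> f T) (at T within {T..})"
      using ac_deriv_leD(1)[OF f] unfolding continuous_on_def by auto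
    then have "(f \<longlongrightarrow> f s) (at_right s)"
      unfolding \<open>s = T\<close> by (rule tendsto_within_subset) auto
    moreover have "\<forall>\<^sub>F r in at_right s. f t \<le> f r"
      using eventually_at_right_real[OF \<open>s < t\<close>]
    proof eventually_elim
      case (elim r)
      then show ?case by (intro decreasing) (auto simp: \<open>s = T\<close>)
    qed
    ultimately show ?thesis by (rule tendsto_lowerbound) simp
  qed (use decreasing[of s] \<open>s \<le> t\<close> in auto)
qed

lemma ac_deriv_le_increment:
  assumes f: "ac_deriv_le T f h" and H_deriv: "\<And>t. (H has_real_derivative h t) (at t)"
    and h_cont: "continuous_on {T<..} h" and "T \<le> s" "s \<le> t"
  shows "f t - f s \<le> H t - H s"
proof -
  have "ac_deriv_le T (\<lambda>t. - H t) (\<lambda>t. - h t)"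
    using H_deriv by (intro C1_imp_ac_deriv_le DERIV_minus continuous_on_minus h_cont
        DERIV_continuous_on[OF has_field_derivative_at_within]) auto
  from ac_deriv_le_add[OF f this] have "ac_deriv_le T (\<lambda>t. f t + - H t) (\<lambda>_. 0)" by simp
  from ac_deriv_le_nonincreasing[OF this \<open>T \<le> s\<close> \<open>s \<le> t\<close>] show ?thesis by simp
qed

lemma ac_deriv_le_gronwall:
  assumes f: "ac_deriv_le T f (\<lambda>t. - k * f t + C)" and "k \<noteq> 0" "T \<le> t"
  shows "f t \<le> exp (- k * (t - T)) * (f T - C / k) + C / k"
proof -
  have "ac_deriv_le T (\<lambda>t. exp (k * t) * f t) (\<lambda>t. C * exp (k * t))"
    using ac_deriv_le_exp_mult[OF f, of k] by (simp add: mult.commute)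
  moreover have "((\<lambda>t. C / k * exp (k * t)) has_real_derivative C * exp (k * t)) (at t)" for t
    using \<open>k \<noteq> 0\<close> by (auto intro!: derivative_eq_intros)
  ultimately have "exp (k * t) * f t - exp (k * T) * f T \<le> C / k * exp (k * t) - C / k * exp (k * T)"
    by (rule ac_deriv_le_increment) (intro continuous_intros \<open>T \<le> t\<close> order_refl)+
  then have "exp (k * t) * (f t - C / k) \<le> exp (k * T) * (f T - C / k)"
    by (simp add: algebra_simps)
  then have "f t - C / k \<le> exp (k * T) / exp (k * t) * (f T - C / k)"
    by (simp add: field_simps)
  also have "exp (k * T) / exp (k * t) = exp (- k * (t - T))"
    by (simp add: exp_diff[symmetric] algebra_simps)
  finally show ?thesis by simp
qed

lemma ac_deriv_le_gronwall_nonneg: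
  assumes f: "ac_deriv_le T f (\<lambda>t. - k * f t + C)" and "k > 0" "C \<ge> 0" "T \<le> t"
  shows "f t \<le> exp (- k * (t - T)) * f T + C / k"
proof -
  have "exp (- k * (t - T)) * (f T - C / k) \<le> exp (- k * (t - T)) * f T"
    using assms by (intro mult_left_mono) auto
  then show ?thesis
    using ac_deriv_le_gronwall[OF f _ \<open>T \<le> t\<close>] \<open>k > 0\<close> by linarith
qed

lemma ac_deriv_le_eventually_less:
  assumes f: "ac_deriv_le T f (\<lambda>t. - k * f t + C)" and "k > 0" "C / k < B"
  shows "\<forall>\<^sub>F t in at_top. f t < B"
proof -
  have "filterlim (\<lambda>t. - T + t) at_top at_top"
    by (rule filterlim_tendsto_add_at_top[OF tendsto_const filterlim_ident])
  then have "filterlim (\<lambda>t. - k * (- T + t)) at_bot at_top"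
    using \<open>k > 0\<close> by (intro filterlim_tendsto_neg_mult_at_bot[OF tendsto_const]) auto
  then have "filterlim (\<lambda>t. - k * (t - T)) at_bot at_top" by simp
  then have "((\<lambda>t. exp (- k * (t - T))) \<longlongrightarrow> 0) at_top"
    by (rule filterlim_compose[OF exp_at_bot])
  then have "((\<lambda>t. exp (- k * (t - T)) * (f T - C / k) + C / k) \<longlongrightarrow> 0 * (f T - C / k) + C / k) at_top"
    by (intro tendsto_intros)
  then have "\<forall>\<^sub>F t in at_top. exp (- k * (t - T)) * (f T - C / k) + C / k < B"
    using \<open>C / k < B\<close> by (intro order_tendstoD(2)) auto
  then show ?thesis
    using eventually_ge_at_top[of T]
  proof eventually_elim
    case (elim t)
    then show ?case
      using ac_deriv_le_gronwall[OF f _ \<open>T \<le> t\<close>] \<open>k > 0\<close> by linarith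
  qed
qed

lemma weighted_young:
  fixes q u v :: real
  assumes "q > 0"
  shows "2 * u * v \<le> q * u^2 + v^2 / q"
proof -
  have "0 \<le> (q * u - v)^2 / q" using assms by simp
  also have "\<dots> = q * u^2 - 2 * u * v + v^2 / q"
    using assms by (simp add: power2_eq_square field_simps)
  finally show ?thesis by simp
qed

lemma Limsup_energy_le:
  assumes N: "ac_deriv_le T (\<lambda>t. (N t)^2) (\<lambda>t. - 2 * q * (N t)^2 + 2 * (m t * N t))"
    and N_nonneg: "\<And>t. 0 \<le> N t" and "q > 0" and "\<mu> \<ge> 0"
    and m: "Limsup at_top (\<lambda>t. ereal (m t)) \<le> ereal \<mu>"
  shows "Limsup at_top (\<lambda>t. ereal (N t)) \<le> ereal (\<mu> / q)"
  unfolding Limsup_ereal_le_iff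
proof (intro allI impI)
  fix B assume "\<mu> / q < B"
  then have "\<mu> < q * B" using \<open>q > 0\<close> by (simp add: field_simps)
  then obtain M where M: "\<mu> < M" "M < q * B" using dense by blast
  have "\<forall>\<^sub>F t in at_top. m t < M" using m M(1) unfolding Limsup_ereal_le_iff by blast
  then obtain S where S: "\<And>t. t \<ge> S \<Longrightarrow> m t < M" unfolding eventually_at_top_linorder by blast
  have "- 2 * q * (N t)^2 + 2 * (m t * N t) \<le> - q * (N t)^2 + M^2 / q" if "t > max S T" for t
  proof -
    have "m t * N t \<le> M * N t" using S[of t] N_nonneg that by (intro mult_right_mono) auto
    moreover have "2 * N t * M \<le> q * (N t)^2 + M^2 / q" by (rule weighted_young[OF \<open>q > 0\<close>])
    ultimately show ?thesis by (simp add: mult.commute)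
  qed
  then have "ac_deriv_le (max S T) (\<lambda>t. (N t)^2) (\<lambda>t. - q * (N t)^2 + M^2 / q)"
    by (intro ac_deriv_le_mono[OF N] AE_lebesgue_on_greaterThanI) auto
  moreover have "M^2 / q / q < B^2"
  proof -
    have "M / q < B" using M(2) \<open>q > 0\<close> by (simp add: field_simps)
    then have "(M / q)^2 < B^2" using M(1) \<open>\<mu> \<ge> 0\<close> \<open>q > 0\<close> by (intro power_strict_mono) auto
    then show ?thesis by (simp add: power_divide power2_eq_square)
  qed
  ultimately have "\<forall>\<^sub>F t in at_top. (N t)^2 < B^2"
    using \<open>q > 0\<close> by (intro ac_deriv_le_eventually_less)
  moreover have "0 \<le> \<mu> / q" using \<open>\<mu> \<ge> 0\<close> \<open>q > 0\<close> by simp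
  then have "0 \<le> B" using \<open>\<mu> / q < B\<close> by linarith
  ultimately show "\<forall>\<^sub>F t in at_top. N t < B"
    by (elim eventually_mono) (rule power2_less_imp_less)
qed

subsection \<open>The Dirichlet Laplacian and the heat equation\<close>

lemma has_real_derivative_tan_midpoint:
  fixes \<omega> a b x :: real
  defines "T \<equiv> \<lambda>x. tan (\<omega> * (x - (a + b) / 2))"
  assumes \<omega>: "0 < \<omega>" "\<omega> * (b - a) < pi" and "x \<in> {a..b}"
  shows "(T has_real_derivative \<omega> * (1 + (T x)^2)) (at x within S)"
proof -
  have "\<bar>\<omega> * (x - (a + b) / 2)\<bar> = \<omega> * \<bar>x - (a + b) / 2\<bar>"
    using \<omega>(1) by (simp add: abs_mult)
  also have "\<dots> \<le> \<omega> * ((b - a) / 2)"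
    using \<omega>(1) \<open>x \<in> {a..b}\<close> by (intro mult_left_mono) (auto simp: abs_le_iff field_simps)
  also have "\<dots> < pi / 2" using \<omega>(2) by simp
  finally have "0 < cos (\<omega> * (x - (a + b) / 2))"
    unfolding abs_less_iff by (intro cos_gt_zero_pi) auto
  then show ?thesis
    unfolding T_def by (auto intro!: derivative_eq_intros simp: tan_sec power_inverse)
qed

text \<open>The square \<open>(f' + \<omega> * f * T)^2\<close> differs from \<open>f'^2 - \<omega>^2 * f^2\<close> by the derivative of
  \<open>\<omega> * f^2 * T\<close>, where the tangent \<open>T\<close> is centred at the midpoint and hence has no singularity
  on the interval as long as \<open>\<omega> < pi / (b - a)\<close>.\<close>

lemma wirtinger_subcritical:
  fixes f :: "real \<Rightarrow> real"
  assumes "a \<le> b" and \<omega>: "0 < \<omega>" "\<omega> * (b - a) < pi"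
    and deriv: "\<And>x. x \<in> {a..b} \<Longrightarrow> (f has_real_derivative f' x) (at x within {a..b})"
    and cont': "continuous_on {a..b} f'" and "f a = 0" "f b = 0"
  shows "\<omega>^2 * integral {a..b} (\<lambda>x. (f x)^2) \<le> integral {a..b} (\<lambda>x. (f' x)^2)"
proof -
  have cont: "continuous_on {a..b} f" by (rule DERIV_continuous_on) (rule deriv)
  define T where "T x = tan (\<omega> * (x - (a + b) / 2))" for x
  have T: "(T has_real_derivative \<omega> * (1 + (T x)^2)) (at x within {a..b})" if "x \<in> {a..b}" for x
    unfolding T_def by (rule has_real_derivative_tan_midpoint[OF \<omega> that])
  have "((\<lambda>x. 2 * \<omega> * f x * f' x * T x + \<omega>^2 * (f x)^2 * (1 + (T x)^2)) has_integral
      \<omega> * (f b)^2 * T b - \<omega> * (f a)^2 * T a) {a..b}"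
  proof (rule fundamental_theorem_of_calculus[OF \<open>a \<le> b\<close>])
    fix x assume x: "x \<in> {a..b}"
    show "((\<lambda>x. \<omega> * (f x)^2 * T x) has_vector_derivative
        2 * \<omega> * f x * f' x * T x + \<omega>^2 * (f x)^2 * (1 + (T x)^2)) (at x within {a..b})"
      unfolding has_real_derivative_iff_has_vector_derivative[symmetric]
      by (rule DERIV_cong[OF DERIV_mult[OF DERIV_cmult[OF DERIV_power[OF deriv[OF x], of 2]] T[OF x]]])
        (simp add: power2_eq_square algebra_simps)
  qed
  moreover have "((\<lambda>x. (f' x)^2) has_integral integral {a..b} (\<lambda>x. (f' x)^2)) {a..b}"
    "((\<lambda>x. \<omega>^2 * (f x)^2) has_integral \<omega>^2 * integral {a..b} (\<lambda>x. (f x)^2)) {a..b}"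
    by (intro has_integral_mult_right integrable_integral integrable_continuous_real continuous_intros
        cont cont')+
  ultimately have "((\<lambda>x. (f' x)^2 - \<omega>^2 * (f x)^2
        + (2 * \<omega> * f x * f' x * T x + \<omega>^2 * (f x)^2 * (1 + (T x)^2))) has_integral
      integral {a..b} (\<lambda>x. (f' x)^2) - \<omega>^2 * integral {a..b} (\<lambda>x. (f x)^2)
        + (\<omega> * (f b)^2 * T b - \<omega> * (f a)^2 * T a)) {a..b}"
    by (intro has_integral_add has_integral_diff)
  also have "(\<lambda>x. (f' x)^2 - \<omega>^2 * (f x)^2 + (2 * \<omega> * f x * f' x * T x + \<omega>^2 * (f x)^2 * (1 + (T x)^2)))
      = (\<lambda>x. (f' x + \<omega> * f x * T x)^2)"
    by (auto simp: power2_eq_square algebra_simps)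
  finally have "0 \<le> integral {a..b} (\<lambda>x. (f' x)^2) - \<omega>^2 * integral {a..b} (\<lambda>x. (f x)^2)
      + (\<omega> * (f b)^2 * T b - \<omega> * (f a)^2 * T a)"
    by (rule has_integral_nonneg) simp
  then show ?thesis using \<open>f a = 0\<close> \<open>f b = 0\<close> by simp
qed

theorem wirtinger:
  fixes f :: "real \<Rightarrow> real"
  assumes "a < b"
    and deriv: "\<And>x. x \<in> {a..b} \<Longrightarrow> (f has_real_derivative f' x) (at x within {a..b})"
    and cont': "continuous_on {a..b} f'" and bc: "f a = 0" "f b = 0"
  shows "(pi / (b - a))^2 * integral {a..b} (\<lambda>x. (f x)^2) \<le> integral {a..b} (\<lambda>x. (f' x)^2)"
proof (rule tendsto_upperbound)
  show "((\<lambda>\<omega>. \<omega>^2 * integral {a..b} (\<lambda>x. (f x)^2)) \<longlongrightarrow> (pi / (b - a))^2 * integral {a..b} (\<lambda>x. (f x)^2))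
      (at_left (pi / (b - a)))"
    by (intro tendsto_intros)
  have "0 < pi / (b - a)" using \<open>a < b\<close> by simp
  from eventually_at_left_real[OF this]
  show "\<forall>\<^sub>F \<omega> in at_left (pi / (b - a)).
      \<omega>^2 * integral {a..b} (\<lambda>x. (f x)^2) \<le> integral {a..b} (\<lambda>x. (f' x)^2)"
  proof eventually_elim
    case (elim \<omega>)
    then show ?case
      using \<open>a < b\<close> by (intro wirtinger_subcritical deriv cont' bc) (auto simp: field_simps)
  qed
qed simp

lemma L2norm_power2_eq_integral:
  assumes "continuous_on {0..1} f"
  shows "(L2norm f)^2 = integral {0..1} (\<lambda>x. (f x)^2)"
  unfolding L2norm_power2 L2inner_def power2_eq_square[symmetric]
  by (intro lebesgue_integral_eq_integral continuous_imp_integrable_real continuous_intros assms) simp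

lemma (in pair_sigma_finite) integrable_mult_pair:
  fixes f :: "'a \<Rightarrow> real" and g :: "'b \<Rightarrow> real"
  assumes f: "integrable M1 f" and g: "integrable M2 g"
  shows "integrable (M1 \<Otimes>\<^sub>M M2) (\<lambda>(x, y). f x * g y)"
proof (rule Fubini_integrable)
  note [measurable] = borel_measurable_integrable[OF f] borel_measurable_integrable[OF g]
  show "(\<lambda>(x, y). f x * g y) \<in> borel_measurable (M1 \<Otimes>\<^sub>M M2)"
    by measurable
  show "integrable M1 (\<lambda>x. \<integral>y. norm (case (x, y) of (x, y) \<Rightarrow> f x * g y) \<partial>M2)"
    using f by (simp add: abs_mult)
  show "AE x in M1. integrable M2 (\<lambda>y. case (x, y) of (x, y) \<Rightarrow> f x * g y)"
    using g by simp
qed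

lemma integral_triangle_swap:
  fixes g h :: "real \<Rightarrow> real"
  assumes g: "integrable (lebesgue_on {a..b}) g" and h: "integrable (lebesgue_on {a..b}) h"
  shows "(\<integral>x. g x * (\<integral>s. h s \<partial>lebesgue_on {x..b}) \<partial>lebesgue_on {a..b})
    = (\<integral>s. h s * (\<integral>x. g x \<partial>lebesgue_on {a..s}) \<partial>lebesgue_on {a..b})"
proof -
  let ?M = "lebesgue_on {a..b}"
  interpret finite_measure ?M by (rule finite_measure_lebesgue_on) simp
  interpret pair_sigma_finite ?M ?M ..
  define F where "F x s = (if x \<le> s then g x * h s else 0)" for x s
  have [measurable]: "(\<lambda>x. x) \<in> borel_measurable ?M"
    using id_borel_measurable_lebesgue_on by (simp add: id_def)
  have "{p \<in> space (?M \<Otimes>\<^sub>M ?M). fst p \<le> snd p} \<in> sets (?M \<Otimes>\<^sub>M ?M)"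
    by measurable
  from integrable_real_mult_indicator[OF this integrable_mult_pair[OF g h]]
  have "integrable (?M \<Otimes>\<^sub>M ?M) (case_prod F)"
    by (rule Bochner_Integration.integrable_cong[THEN iffD1, rotated 2])
      (auto simp: F_def space_pair_measure split: split_indicator)
  then have swap: "(\<integral>s. (\<integral>x. F x s \<partial>?M) \<partial>?M) = (\<integral>x. (\<integral>s. F x s \<partial>?M) \<partial>?M)"
    by (rule Fubini_integral)
  have inner_s: "(\<integral>s. F x s \<partial>?M) = g x * (\<integral>s. h s \<partial>lebesgue_on {x..b})" if "x \<in> {a..b}" for x
  proof -
    have "(\<integral>s. F x s \<partial>?M) = (\<integral>s. g x * (if s \<in> {x..b} then h s else 0) \<partial>?M)"
      by (intro Bochner_Integration.integral_cong) (auto simp: F_def)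
    also have "\<dots> = g x * (\<integral>s. (if s \<in> {x..b} then h s else 0) \<partial>?M)"
      by (rule integral_mult_right_zero)
    finally show ?thesis using that by (subst (asm) integral_restrict) auto
  qed
  have inner_x: "(\<integral>x. F x s \<partial>?M) = h s * (\<integral>x. g x \<partial>lebesgue_on {a..s})" if "s \<in> {a..b}" for s
  proof -
    have "(\<integral>x. F x s \<partial>?M) = (\<integral>x. h s * (if x \<in> {a..s} then g x else 0) \<partial>?M)"
      by (intro Bochner_Integration.integral_cong) (auto simp: F_def)
    also have "\<dots> = h s * (\<integral>x. (if x \<in> {a..s} then g x else 0) \<partial>?M)"
      by (rule integral_mult_right_zero)
    finally show ?thesis using that by (subst (asm) integral_restrict) auto
  qed
  have "(\<integral>x. g x * (\<integral>s. h s \<partial>lebesgue_on {x..b}) \<partial>?M) = (\<integral>x. (\<integral>s. F x s \<partial>?M) \<partial>?M)"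
    by (intro Bochner_Integration.integral_cong) (simp_all add: inner_s)
  also have "\<dots> = (\<integral>s. (\<integral>x. F x s \<partial>?M) \<partial>?M)" by (rule swap[symmetric])
  also have "\<dots> = (\<integral>s. h s * (\<integral>x. g x \<partial>lebesgue_on {a..s}) \<partial>?M)"
    by (intro Bochner_Integration.integral_cong) (simp_all add: inner_x)
  finally show ?thesis .
qed

lemma H2_withD:
  assumes "H2_with f f' f''"
  shows "x \<in> {0..1} \<Longrightarrow> (f has_real_derivative f' x) (at x within {0..1})"
    and "in_L2 f''"
    and "x \<in> {0..1} \<Longrightarrow> (\<integral>s. f'' s \<partial>lebesgue_on {0..x}) = f' x - f' 0"
proof -
  show "in_L2 f''" using assms unfolding H2_with_def by blast
  show "(f has_real_derivative f' x) (at x within {0..1})" if "x \<in> {0..1}"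
    using assms that unfolding H2_with_def by blast
  have "f' x = f' 0 + (\<integral>s. f'' s \<partial>lebesgue_on {0..x})" if "x \<in> {0..1}"
    using assms that unfolding H2_with_def by blast
  then show "(\<integral>s. f'' s \<partial>lebesgue_on {0..x}) = f' x - f' 0" if "x \<in> {0..1}"
    using that by simp
qed

lemma H2_with_continuous:
  assumes H2: "H2_with f f' f''"
  shows "continuous_on {0..1} f" "continuous_on {0..1} f'"
proof -
  show "continuous_on {0..1} f"
    by (rule DERIV_continuous_on[OF H2_withD(1)[OF H2]])
  have "continuous_on {0..1} (\<lambda>x. f' 0 + (\<integral>s. f'' s \<partial>lebesgue_on {0..x}))"
    by (intro continuous_intros indefinite_integral_continuous_real in_L2_imp_integrable
        H2_withD(2)[OF H2])
  then show "continuous_on {0..1} f'"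
    by (rule continuous_on_eq) (simp add: H2_withD(3)[OF H2])
qed

lemma H2_with_integral_deriv:
  assumes H2: "H2_with f f' f''" and x: "x \<in> {0..1}"
  shows "(\<integral>s. f' s \<partial>lebesgue_on {x..1}) = f 1 - f x"
proof -
  have "(\<integral>s. f' s \<partial>lebesgue_on {x..1}) = integral {x..1} f'"
    using x by (intro lebesgue_integral_eq_integral continuous_imp_integrable_real
        continuous_on_subset[OF H2_with_continuous(2)[OF H2]]) auto
  also have "(f' has_integral f 1 - f x) {x..1}"
  proof (rule fundamental_theorem_of_calculus)
    fix s assume "s \<in> {x..1}"
    then have "s \<in> {0..1}" using x by auto
    then have "(f has_vector_derivative f' s) (at s within {0..1})"
      unfolding has_real_derivative_iff_has_vector_derivative[symmetric] by (rule H2_withD(1)[OF H2])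
    then show "(f has_vector_derivative f' s) (at s within {x..1})"
      by (rule has_vector_derivative_within_subset) (use x in auto)
  qed (use x in auto)
  then have "integral {x..1} f' = f 1 - f x" by (rule integral_unique)
  finally show ?thesis .
qed

lemma L2inner_second_derivative:
  assumes H2: "H2_with f f' f''" and bc: "f 0 = 0" "f 1 = 0"
  shows "L2inner f f'' = - ((L2norm f')^2)"
proof -
  let ?M = "lebesgue_on {0..1::real}"
  have f': "in_L2 f'" by (intro in_L2_continuous H2_with_continuous[OF H2])
  have "- L2inner f f'' = (\<integral>x. - (f x * f'' x) \<partial>?M)"
    unfolding L2inner_def by simp
  also have "\<dots> = (\<integral>x. f'' x * (\<integral>s. f' s \<partial>lebesgue_on {x..1}) \<partial>?M)"
    by (intro Bochner_Integration.integral_cong) (simp_all add: H2_with_integral_deriv[OF H2] bc)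
  also have "\<dots> = (\<integral>s. f' s * (\<integral>x. f'' x \<partial>lebesgue_on {0..s}) \<partial>?M)"
    by (intro integral_triangle_swap in_L2_imp_integrable f' H2_withD(2)[OF H2])
  also have "\<dots> = (\<integral>s. f' s * f' s - f' 0 * f' s \<partial>?M)"
    by (intro Bochner_Integration.integral_cong)
      (simp_all add: H2_withD(3)[OF H2] right_diff_distrib mult.commute)
  also have "\<dots> = (L2norm f')^2 - f' 0 * (\<integral>s. f' s \<partial>?M)"
    using in_L2_integrable_mult[OF f' f'] in_L2_imp_integrable[OF f']
    unfolding L2norm_power2 L2inner_def by simp
  also have "(\<integral>s. f' s \<partial>?M) = 0"
    using H2_with_integral_deriv[OF H2, of 0] bc by simp
  finally show ?thesis by simp
qed

lemma L2inner_second_derivative_le: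
  assumes H2: "H2_with f f' f''" and bc: "f 0 = 0" "f 1 = 0"
  shows "L2inner f f'' \<le> - (pi^2) * (L2norm f)^2"
proof -
  have "pi^2 * (L2norm f)^2 \<le> (L2norm f')^2"
    using wirtinger[of 0 1 f f'] H2_withD(1)[OF H2] H2_with_continuous[OF H2] bc
    by (simp add: L2norm_power2_eq_integral)
  then show ?thesis
    unfolding L2inner_second_derivative[OF assms] by simp
qed

lemma heat_energy_inequality:
  assumes H2: "H2_with f f' f''" and bc: "f 0 = 0" "f 1 = 0" and g: "in_L2 g" and "p \<ge> 0"
    and source: "AE x in lebesgue_on {0..1}. g x = p * f'' x + h x"
    and source_le: "\<And>x. x \<in> {0..1} \<Longrightarrow> \<bar>h x\<bar> \<le> m"
  shows "L2inner f g \<le> - (p * pi^2) * (L2norm f)^2 + m * L2norm f"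
proof -
  define r where "r x = g x - p * f'' x" for x
  have f: "in_L2 f" by (intro in_L2_continuous H2_with_continuous[OF H2])
  have f'': "in_L2 f''" by (rule H2_withD(2)[OF H2])
  have r: "in_L2 r" unfolding r_def by (intro in_L2_diff g in_L2_cmult f'')
  have "L2norm r \<le> m"
  proof (rule L2norm_le_of_AE_bound[OF r])
    have "AE x in lebesgue_on {0..1}. \<bar>h x\<bar> \<le> m" by (intro AE_I2) (simp add: source_le)
    with source show "AE x in lebesgue_on {0..1}. \<bar>r x\<bar> \<le> m"
      by eventually_elim (simp add: r_def)
    show "0 \<le> m" using source_le[of 0] by simp
  qed
  have "L2inner f g = L2inner f (\<lambda>x. p * f'' x + r x)" unfolding r_def by simp
  also have "\<dots> = p * L2inner f f'' + L2inner f r"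
    by (simp add: L2inner_add_right[OF f in_L2_cmult[OF f''] r] L2inner_cmult_right)
  also have "p * L2inner f f'' \<le> p * (- (pi^2) * (L2norm f)^2)"
    by (intro mult_left_mono L2inner_second_derivative_le[OF H2 bc] \<open>p \<ge> 0\<close>)
  also have "L2inner f r \<le> L2norm f * L2norm r"
    using L2_Cauchy_Schwarz[OF f r] by simp
  also have "\<dots> \<le> L2norm f * m"
    using \<open>L2norm r \<le> m\<close> by (intro mult_left_mono) auto
  finally show ?thesis by (simp add: mult_ac)
qed

lemma heat_L2norm_power2_ac_deriv_le:
  fixes w wt wx wxx h :: "real \<Rightarrow> real \<Rightarrow> real"
  assumes w: "L2_continuous_on {0..} w" and wt: "L2_continuous_on {0<..} wt"
    and wt_lim: "\<And>t. t > 0 \<Longrightarrow>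
      ((\<lambda>s. L2norm (\<lambda>x. (w s x - w t x) / (s - t) - wt t x)) \<longlongrightarrow> 0) (at t)"
    and H2: "\<And>t. t > 0 \<Longrightarrow> H2_with (w t) (wx t) (wxx t)"
    and bc: "\<And>t. t > 0 \<Longrightarrow> w t 0 = 0" "\<And>t. t > 0 \<Longrightarrow> w t 1 = 0" and "p \<ge> 0"
    and source: "\<And>t. t > 0 \<Longrightarrow> AE x in lebesgue_on {0..1}. wt t x = p * wxx t x + h t x"
    and source_le: "\<And>t x. t > 0 \<Longrightarrow> x \<in> {0..1} \<Longrightarrow> \<bar>h t x\<bar> \<le> m t"
  shows "ac_deriv_le 0 (\<lambda>t. (L2norm (w t))^2)
    (\<lambda>t. - 2 * (p * pi^2) * (L2norm (w t))^2 + 2 * (m t * L2norm (w t)))"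
proof (rule ac_deriv_le_mono[OF C1_imp_ac_deriv_le order_refl])
  have w_pos: "L2_continuous_on {0<..} w"
    by (rule L2_continuous_on_subset[OF w]) auto
  have in_L2_wt: "in_L2 (wt t)" if "0 < t" for t
    using wt that unfolding L2_continuous_on_def by auto
  show "continuous_on {0..} (\<lambda>t. (L2norm (w t))^2)"
    unfolding L2norm_power2 by (rule L2_continuous_on_inner[OF w w])
  show "continuous_on {0<..} (\<lambda>t. 2 * L2inner (w t) (wt t))"
    by (intro continuous_intros L2_continuous_on_inner[OF w_pos wt])
  show "((\<lambda>t. (L2norm (w t))^2) has_real_derivative 2 * L2inner (w t) (wt t)) (at t)" if "0 < t" for t
    using that by (intro L2norm_power2_has_real_derivative[OF w_pos] in_L2_wt wt_lim) auto
  show "AE t in lebesgue_on {0<..}. 2 * L2inner (w t) (wt t)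
      \<le> - 2 * (p * pi^2) * (L2norm (w t))^2 + 2 * (m t * L2norm (w t))"
  proof (rule AE_lebesgue_on_greaterThanI)
    fix t :: real assume t: "0 < t"
    have "L2inner (w t) (wt t) \<le> - (p * pi^2) * (L2norm (w t))^2 + m t * L2norm (w t)"
      by (rule heat_energy_inequality[OF H2[OF t] bc[OF t] in_L2_wt[OF t] \<open>p \<ge> 0\<close> source[OF t]
            source_le[OF t]])
    then show "2 * L2inner (w t) (wt t)
        \<le> - 2 * (p * pi^2) * (L2norm (w t))^2 + 2 * (m t * L2norm (w t))"
      by simp
  qed
qed

subsection \<open>Young-type estimates for the controller\<close>

definition control :: "real \<Rightarrow> real \<Rightarrow> real \<Rightarrow> real \<Rightarrow> real" where
  "control c a B y = - c * (1 + B^7 / (4 * a^6)) * (y^7 + y^3 + y)"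

lemma power_le_gain:
  fixes a B r :: real
  assumes "0 < a" "1 \<le> B" "1 \<le> r" "r \<le> B / a" "j \<le> 6"
  shows "r^j \<le> B^7 / a^6"
proof -
  have "r^j \<le> r^6" using assms by (intro power_increasing) auto
  also have "\<dots> \<le> (B / a)^6" using assms by (intro power_mono) auto
  also have "\<dots> \<le> B * (B / a)^6" using assms by (intro mult_le_cancel_right1[THEN iffD2]) auto
  also have "\<dots> = B^7 / a^6" by (simp add: power_divide power_numeral_reduce)
  finally show ?thesis .
qed

lemma control_dissipation:
  assumes "c \<ge> 1" and ratio: "0 < a" "1 \<le> B" "1 \<le> r" "r \<le> B / a"
  shows "y * control c a B y \<le> - (c * y^2) - y^4 - (r * y^2 + r^3 * y^4 + r^3 * y^8) / 4"
proof -
  define g where "g = B^7 / a^6"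
  have r_powers: "r \<le> g" "r^3 \<le> g"
    using power_le_gain[OF ratio, of 1] power_le_gain[OF ratio, of 3] unfolding g_def by auto
  have "r * y^2 + r^3 * y^4 + r^3 * y^8 \<le> g * y^2 + g * y^4 + g * y^8"
    using r_powers by (intro add_mono mult_right_mono) auto
  then have "y^4 + (r * y^2 + r^3 * y^4 + r^3 * y^8) / 4 \<le> y^8 + y^4 + g / 4 * (y^8 + y^4 + y^2)"
    by (simp add: distrib_left add_divide_distrib add_increasing)
  also have "\<dots> \<le> c * (y^8 + y^4 + g / 4 * (y^8 + y^4 + y^2))"
    using mult_right_mono[OF \<open>c \<ge> 1\<close>, of "y^8 + y^4 + g / 4 * (y^8 + y^4 + y^2)"]
      r_powers(1) \<open>1 \<le> r\<close> by simp
  finally have "y^4 + (r * y^2 + r^3 * y^4 + r^3 * y^8) / 4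
      \<le> c * (y^8 + y^4 + g / 4 * (y^8 + y^4 + y^2))" .
  moreover have "y * control c a B y = - c * (1 + g / 4) * (y * (y^7 + y^3 + y))"
    unfolding control_def g_def by simp
  moreover have "y * (y^7 + y^3 + y) = y^8 + y^4 + y^2"
    by (simp add: distrib_left power_numeral_reduce)
  moreover have "- c * (1 + g / 4) * (y^8 + y^4 + y^2)
      = - (c * y^2) - c * (y^8 + y^4 + g / 4 * (y^8 + y^4 + y^2))"
    by (simp add: algebra_simps)
  ultimately show ?thesis by simp
qed

lemma mult_disturbance_le:
  fixes y :: real
  assumes "\<bar>d\<bar> \<le> D" "r > 0"
  shows "y * d \<le> D^2 / r + r * y^2 / 4"
proof -
  have "y * d \<le> \<bar>y\<bar> * \<bar>d\<bar>" using abs_ge_self[of "y * d"] by (simp add: abs_mult)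
  also have "\<dots> \<le> \<bar>y\<bar> * D" using assms(1) by (intro mult_left_mono) auto
  also have "\<dots> = 2 * D * (\<bar>y\<bar> / 2)" by simp
  also have "\<dots> \<le> 1 / r * D^2 + (\<bar>y\<bar> / 2)^2 / (1 / r)"
    using assms(2) by (intro weighted_young) simp
  finally show ?thesis by (simp add: power_divide mult_ac)
qed

lemma coupling_le:
  fixes y :: real
  assumes "q > 0" and \<theta>: "\<theta>1^2 + \<theta>2^2 \<le> \<Theta>^2" and l: "\<bar>l\<bar> \<le> N"
  shows "\<bar>\<theta>1\<bar> * \<bar>y\<bar> * N + y * (\<theta>2 * l) \<le> 3 / 4 * q * N^2 + \<Theta>^2 * y^2 / q"
proof -
  have "2 * N * (\<bar>\<theta>1\<bar> * \<bar>y\<bar>) \<le> q * N^2 + \<theta>1^2 * (y^2 / q)"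
    using weighted_young[OF \<open>q > 0\<close>, of N "\<bar>\<theta>1\<bar> * \<bar>y\<bar>"] by (simp add: power_mult_distrib)
  moreover have "2 * N * (\<bar>\<theta>2\<bar> * \<bar>y\<bar>) \<le> q / 2 * N^2 + 2 * \<theta>2^2 * (y^2 / q)"
    using weighted_young[of "q / 2" N "\<bar>\<theta>2\<bar> * \<bar>y\<bar>"] \<open>q > 0\<close> by (simp add: power_mult_distrib)
  moreover have "y * (\<theta>2 * l) \<le> \<bar>\<theta>2\<bar> * \<bar>y\<bar> * N"
    using abs_ge_self[of "y * (\<theta>2 * l)"] mult_left_mono[OF l, of "\<bar>\<theta>2\<bar> * \<bar>y\<bar>"]
    by (simp add: abs_mult mult_ac)
  moreover have "(\<theta>1^2 + 2 * \<theta>2^2) * (y^2 / q) \<le> 2 * \<Theta>^2 * (y^2 / q)"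
  proof (rule mult_right_mono)
    show "\<theta>1^2 + 2 * \<theta>2^2 \<le> 2 * \<Theta>^2" using \<theta> zero_le_power2[of \<theta>1] by linarith
  qed (use \<open>q > 0\<close> in simp)
  ultimately show ?thesis by (simp add: algebra_simps)
qed

lemma parameter_output_le_quartic:
  fixes y :: real
  assumes "q > 0"
  shows "\<Theta>^2 * y^2 / q \<le> \<Theta>^4 / (2 * q^2) + y^4 / 2"
  using weighted_young[of "1/2" "y^2" "\<Theta>^2 / (2 * q)"] assms
  by (simp add: power_divide power_mult_distrib field_simps)

lemma parameter_output_le_octic:
  fixes y :: real
  assumes p: "0 < p" "p \<le> q" and r: "0 < r"
  shows "\<Theta>^2 * y^2 / q \<le> 2 * ((\<Theta>^8 + 2 / p^2) / r) + r^3 * y^8 / 2"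
proof -
  have "\<Theta>^2 * y^2 / q \<le> \<Theta>^2 * y^2 / p"
    using p by (intro divide_left_mono) auto
  also have "\<dots> = 2 * (1 / p) * (\<Theta>^2 * y^2 / 2)" by simp
  also have "\<dots> \<le> 4 / r * (1 / p)^2 + (\<Theta>^2 * y^2 / 2)^2 / (4 / r)"
    using r by (intro weighted_young) auto
  also have "(\<Theta>^2 * y^2 / 2)^2 / (4 / r) = 2 * \<Theta>^4 * (r * y^4 / 32)"
    by (simp add: power_mult_distrib power_divide)
  also have "\<dots> \<le> 2 / r * (\<Theta>^4)^2 + (r * y^4 / 32)^2 / (2 / r)"
    using r by (intro weighted_young) auto
  also have "(r * y^4 / 32)^2 / (2 / r) = r^3 * y^8 / 2 / 1024"
    by (simp add: power_mult_distrib power_divide power2_eq_square power3_eq_cube)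
  also have "\<dots> \<le> r^3 * y^8 / 2" using r by simp
  finally show ?thesis by (simp add: power_divide add_divide_distrib mult.commute[of r])
qed

lemma coupling_le_quartic:
  fixes y :: real
  assumes "q > 0" and "r > 0" and \<theta>: "\<bar>\<theta>\<bar> \<le> \<bar>\<Theta>\<bar>" and l: "\<bar>l\<bar> \<le> N"
  shows "y * (\<theta> * l) \<le> (q / 2 * N^2 + \<Theta>^4 / (4 * q^2)) / r + r^3 * y^4 / 4"
proof -
  have "y * (\<theta> * l) \<le> \<bar>y\<bar> * (\<bar>\<theta>\<bar> * \<bar>l\<bar>)" using abs_ge_self[of "y * (\<theta> * l)"] by (simp add: abs_mult)
  also have "\<dots> \<le> \<bar>y\<bar> * (\<bar>\<Theta>\<bar> * N)"
    using \<theta> l by (intro mult_left_mono mult_mono) auto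
  also have "\<dots> = 2 * N * (\<bar>\<Theta>\<bar> * \<bar>y\<bar> / 2)" by simp
  also have "\<dots> \<le> q / (2 * r) * N^2 + (\<bar>\<Theta>\<bar> * \<bar>y\<bar> / 2)^2 / (q / (2 * r))"
    using assms by (intro weighted_young) auto
  also have "(\<bar>\<Theta>\<bar> * \<bar>y\<bar> / 2)^2 / (q / (2 * r)) = 2 * (\<Theta>^2 / (2 * q)) * (r * y^2 / 2)"
    by (simp add: power_mult_distrib power_divide mult_ac)
  also have "\<dots> \<le> 1 / r * (\<Theta>^2 / (2 * q))^2 + (r * y^2 / 2)^2 / (1 / r)"
    using assms by (intro weighted_young) auto
  also have "(r * y^2 / 2)^2 / (1 / r) = r^3 * y^4 / 4"
    by (simp add: power_mult_distrib power_divide power2_eq_square power3_eq_cube power4_eq_xxxx)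
  also have "1 / r * (\<Theta>^2 / (2 * q))^2 = 1 / r * (\<Theta>^4 / (4 * q^2))"
    by (simp add: power_divide power_mult_distrib)
  finally show ?thesis by (simp add: add_divide_distrib mult_ac)
qed

lemma total_energy_decay:
  fixes y :: real
  assumes p: "0 < p" "p \<le> q" and "c \<ge> 1" and ratio: "0 < a" "1 \<le> B" "1 \<le> r" "r \<le> B / a"
    and \<theta>: "\<theta>1^2 + \<theta>2^2 \<le> \<Theta>^2" and l: "\<bar>l\<bar> \<le> N" and d: "\<bar>d\<bar> \<le> D"
    and \<kappa>: "\<kappa> \<le> q / 2" "\<kappa> \<le> 2 * c"
  shows "- 2 * q * N^2 + 2 * (\<bar>\<theta>1\<bar> * \<bar>y\<bar> * N) + 2 * (y * (control c a B y + \<theta>2 * l + d))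
    \<le> - (\<kappa> * (N^2 + y^2)) + (2 * ((D^2 + \<Theta>^8 + 2 / p^2) / r) + \<Theta>^4 / (2 * q^2))"
proof -
  have "q > 0" "r > 0" using p ratio by auto
  note control_dissipation[OF \<open>c \<ge> 1\<close> ratio, of y] coupling_le[OF \<open>q > 0\<close> \<theta> l, of y]
    mult_disturbance_le[OF d \<open>r > 0\<close>, of y]
    parameter_output_le_quartic[OF \<open>q > 0\<close>, of \<Theta> y] parameter_output_le_octic[OF p \<open>r > 0\<close>, of \<Theta> y]
  moreover have "\<kappa> * (N^2 + y^2) \<le> q / 2 * N^2 + 2 * (c * y^2)"
    using mult_right_mono[OF \<kappa>(1), of "N^2"] mult_right_mono[OF \<kappa>(2), of "y^2"]
    by (simp add: distrib_left)
  moreover have "0 \<le> y^4" "0 \<le> r^3 * y^4"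
    using \<open>r > 0\<close> by auto
  ultimately show ?thesis
    unfolding distrib_left add_divide_distrib mult_minus_left by linarith
qed

lemma output_energy_decay:
  fixes y :: real
  assumes "q > 0" and "c \<ge> 1" and ratio: "0 < a" "1 \<le> B" "1 \<le> r" "r \<le> B / a"
    and \<theta>: "\<bar>\<theta>\<bar> \<le> \<bar>\<Theta>\<bar>" and l: "\<bar>l\<bar> \<le> N" and d: "\<bar>d\<bar> \<le> D"
  shows "y * (control c a B y + \<theta> * l + d)
    \<le> - (c * y^2) + (D^2 + q / 2 * N^2 + \<Theta>^4 / (4 * q^2)) / r"
proof -
  have "r > 0" using ratio by auto
  note control_dissipation[OF \<open>c \<ge> 1\<close> ratio, of y] coupling_le_quartic[OF \<open>q > 0\<close> \<open>r > 0\<close> \<theta> l, of y]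
    mult_disturbance_le[OF d \<open>r > 0\<close>, of y]
  moreover have "0 \<le> y^4" "0 \<le> r^3 * y^8"
    using \<open>r > 0\<close> by auto
  ultimately show ?thesis
    unfolding distrib_left add_divide_distrib by linarith
qed

text \<open>For \<open>q < 1/2\<close> the term \<open>\<Theta>^4 / (4 * q^2)\<close> is absorbed by the products of
  \<open>1 / (4 * q * \<kappa>)\<close> with \<open>\<Theta>^8\<close> and \<open>2 / p^2\<close>.\<close>

lemma parameter_quartic_le:
  fixes \<Theta> :: real
  assumes p: "0 < p" "p \<le> q" and \<kappa>: "0 < \<kappa>" "\<kappa> \<le> q / 2"
  shows "\<Theta>^4 / (4 * q^2) \<le> \<Theta>^4 + 1 / (4 * q * \<kappa>) * (\<Theta>^8 + 2 / p^2)"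
proof (cases "q \<ge> 1/2")
  case True
  then have "(1/2)^2 \<le> q^2" by (intro power_mono) auto
  then have "\<Theta>^4 / (4 * q^2) \<le> \<Theta>^4 / 1" by (intro divide_left_mono) (auto simp: power2_eq_square)
  moreover have "0 \<le> 1 / (4 * q * \<kappa>) * (\<Theta>^8 + 2 / p^2)"
    using p \<kappa> by (intro mult_nonneg_nonneg) auto
  ultimately show ?thesis by simp
next
  case False
  then have "p^2 \<le> 1" using p by (intro power_le_one) auto
  then have "1 \<le> 2 / p^2" using p by (simp add: field_simps)
  moreover have "2 * \<Theta>^4 \<le> 1 + \<Theta>^8" using weighted_young[of 1 1 "\<Theta>^4"] by simp
  moreover have "0 \<le> \<Theta>^4" by simp
  ultimately have "\<Theta>^4 \<le> \<Theta>^8 + 2 / p^2" by linarith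
  moreover have "4 * q * \<kappa> \<le> 4 * q^2"
    using p \<kappa> mult_left_mono[of \<kappa> q q] by (simp add: power2_eq_square)
  then have "1 / (4 * q^2) \<le> 1 / (4 * q * \<kappa>)" using p \<kappa> by (intro divide_left_mono) auto
  ultimately have "1 / (4 * q^2) * \<Theta>^4 \<le> 1 / (4 * q * \<kappa>) * (\<Theta>^8 + 2 / p^2)"
    using p \<kappa> by (intro mult_mono) auto
  then show ?thesis by (simp add: add_increasing)
qed

lemma disturbance_gain_le:
  fixes p q \<kappa> a b W D \<Theta> :: real
  assumes p: "0 < p" "p \<le> q" and \<kappa>: "0 < \<kappa>" "\<kappa> \<le> q / 2" and "0 < a" "0 < b" "0 \<le> W"
  shows "D^2 + q / 2 * (W + (2 * a * (D^2 + \<Theta>^8 + 2 / p^2) / (b * \<kappa>) + \<Theta>^4 / (2 * q^2 * \<kappa>)))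
      + \<Theta>^4 / (4 * q^2)
    \<le> (1 + a * q / (b * \<kappa>) + q / 2 + 1 / (4 * q * \<kappa>)) * (D^2 + \<Theta>^4 + \<Theta>^8 + 2 / p^2 + W)"
proof -
  define k\<^sub>1 k\<^sub>2 where "k\<^sub>1 = a * q / (b * \<kappa>)" and "k\<^sub>2 = 1 / (4 * q * \<kappa>)"
  have k_nonneg: "k\<^sub>1 \<ge> 0" "k\<^sub>2 \<ge> 0"
    unfolding k\<^sub>1_def k\<^sub>2_def using assms by auto
  have "q / 2 * (W + (2 * a * (D^2 + \<Theta>^8 + 2 / p^2) / (b * \<kappa>) + \<Theta>^4 / (2 * q^2 * \<kappa>)))
      = q / 2 * W + k\<^sub>1 * (D^2 + \<Theta>^8 + 2 / p^2) + k\<^sub>2 * \<Theta>^4"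
    unfolding k\<^sub>1_def k\<^sub>2_def using assms by (simp add: field_simps power2_eq_square)
  moreover have "\<Theta>^4 / (4 * q^2) \<le> \<Theta>^4 + k\<^sub>2 * (\<Theta>^8 + 2 / p^2)"
    unfolding k\<^sub>2_def by (rule parameter_quartic_le[OF p \<kappa>])
  moreover have "0 \<le> D^2" "0 \<le> \<Theta>^4" "0 \<le> \<Theta>^8" "0 \<le> 2 / p^2" by auto
  moreover have "0 \<le> k\<^sub>1 * (\<Theta>^4 + W)" "0 \<le> q / 2 * (D^2 + \<Theta>^4 + \<Theta>^8 + 2 / p^2)" "0 \<le> k\<^sub>2 * (D^2 + W)"
    using k_nonneg \<open>0 \<le> W\<close> p by (auto intro!: mult_nonneg_nonneg add_nonneg_nonneg)
  moreover have "(1 + k\<^sub>1 + q / 2 + k\<^sub>2) * (D^2 + \<Theta>^4 + \<Theta>^8 + 2 / p^2 + W)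
      = D^2 + \<Theta>^4 + \<Theta>^8 + 2 / p^2 + W + k\<^sub>1 * (D^2 + \<Theta>^8 + 2 / p^2) + k\<^sub>1 * (\<Theta>^4 + W) + q / 2 * W
        + q / 2 * (D^2 + \<Theta>^4 + \<Theta>^8 + 2 / p^2) + k\<^sub>2 * \<Theta>^4 + k\<^sub>2 * (\<Theta>^8 + 2 / p^2) + k\<^sub>2 * (D^2 + W)"
    by (simp add: algebra_simps add_divide_distrib)
  ultimately show ?thesis
    unfolding k\<^sub>1_def[symmetric] k\<^sub>2_def[symmetric] using \<open>0 \<le> W\<close> by linarith
qed

subsection \<open>Adaptation with a dead zone\<close>

locale adaptive_gain =
  fixes V g :: "real \<Rightarrow> real" and \<Gamma> \<epsilon> :: real
  assumes \<Gamma>_pos: "0 < \<Gamma>" and \<epsilon>_pos: "0 < \<epsilon>"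
    and V_nonneg: "0 \<le> V t" and g_nonneg: "0 \<le> g t"
    and V_cont: "continuous_on {0..} V" and g_cont: "continuous_on {0..} g"
    and g_deriv: "0 < t \<Longrightarrow> (g has_real_derivative \<Gamma> * max (V t - \<epsilon>) 0) (at t)"
begin

lemma gain_ac_deriv_le: "ac_deriv_le 0 g (\<lambda>t. \<Gamma> * max (V t - \<epsilon>) 0)"
  by (intro C1_imp_ac_deriv_le g_cont g_deriv continuous_intros continuous_on_subset[OF V_cont]) auto

lemma gain_increment_ge:
  assumes "0 \<le> s" "s \<le> t" and excess_ge: "\<And>u. s < u \<Longrightarrow> u < t \<Longrightarrow> \<eta> \<le> max (V u - \<epsilon>) 0"
  shows "\<Gamma> * \<eta> * (t - s) \<le> g t - g s"
proof -
  have "g s - \<Gamma> * \<eta> * s \<le> g t - \<Gamma> * \<eta> * t"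
  proof (rule DERIV_nonneg_imp_increasing_open[OF \<open>s \<le> t\<close>])
    show "continuous_on {s..t} (\<lambda>u. g u - \<Gamma> * \<eta> * u)"
      using \<open>0 \<le> s\<close> by (intro continuous_intros continuous_on_subset[OF g_cont]) auto
    fix u assume u: "s < u" "u < t"
    have "((\<lambda>u. g u - \<Gamma> * \<eta> * u) has_real_derivative \<Gamma> * max (V u - \<epsilon>) 0 - \<Gamma> * \<eta> * 1) (at u)"
      using u \<open>0 \<le> s\<close> by (intro DERIV_diff g_deriv DERIV_cmult DERIV_ident) auto
    moreover have "\<Gamma> * \<eta> \<le> \<Gamma> * max (V u - \<epsilon>) 0"
      using excess_ge[OF u] \<Gamma>_pos by (intro mult_left_mono) auto
    ultimately show "\<exists>D. ((\<lambda>u. g u - \<Gamma> * \<eta> * u) has_real_derivative D) (at u) \<and> 0 \<le> D"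
      by (intro exI[of _ "\<Gamma> * max (V u - \<epsilon>) 0 - \<Gamma> * \<eta> * 1"]) simp
  qed
  then show ?thesis by (simp add: algebra_simps)
qed

lemma gain_mono: "0 \<le> s \<Longrightarrow> s \<le> t \<Longrightarrow> g s \<le> g t"
  using gain_increment_ge[of s t 0] by simp

lemma gain_le_of_exp_decay:
  assumes "0 \<le> T" "T \<le> t" "k > 0" "A \<ge> 0"
    and decay: "\<And>s. T < s \<Longrightarrow> V s - \<epsilon> \<le> A * exp (- k * (s - T))"
  shows "g t \<le> g T + \<Gamma> * A / k"
proof -
  have "\<Gamma> * max (V s - \<epsilon>) 0 \<le> \<Gamma> * A * exp (- k * (s - T))" if "T < s" for s
    using decay[OF that] \<Gamma>_pos \<open>A \<ge> 0\<close> by (simp add: mult.assoc)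
  then have "ac_deriv_le T g (\<lambda>s. \<Gamma> * A * exp (- k * (s - T)))"
    by (intro ac_deriv_le_mono[OF gain_ac_deriv_le \<open>0 \<le> T\<close>] AE_lebesgue_on_greaterThanI)
  moreover have "((\<lambda>s. - (\<Gamma> * A / k) * exp (- k * (s - T))) has_real_derivative
      \<Gamma> * A * exp (- k * (s - T))) (at s)" for s
    using \<open>k > 0\<close> by (auto intro!: derivative_eq_intros)
  ultimately have "g t - g T
      \<le> - (\<Gamma> * A / k) * exp (- k * (t - T)) - - (\<Gamma> * A / k) * exp (- k * (T - T))"
    by (rule ac_deriv_le_increment) (intro continuous_intros order_refl \<open>T \<le> t\<close>)+
  moreover have "0 \<le> \<Gamma> * A / k * exp (- k * (t - T))"
    using \<Gamma>_pos \<open>A \<ge> 0\<close> \<open>k > 0\<close> by simp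
  ultimately show ?thesis by simp
qed

lemma gain_crossing:
  assumes "0 \<le> t" "0 \<le> b" "0 \<le> \<sigma>" "\<sigma> \<le> b + g t"
  obtains T where "0 \<le> T" "T \<le> t" "\<sigma> \<le> b + g T" "g T \<le> g 0 + \<sigma>"
proof (cases "\<sigma> \<le> b + g 0")
  case True
  then show thesis using assms by (intro that[of 0]) auto
next
  case False
  have "continuous_on {0..t} g" by (rule continuous_on_subset[OF g_cont]) auto
  then obtain T where "0 \<le> T" "T \<le> t" "g T = \<sigma> - b"
    using IVT'[of g 0 "\<sigma> - b" t] False assms by auto
  then show thesis using assms g_nonneg[of 0] by (intro that[of T]) auto
qed

lemma divide_gain_le: "b \<ge> 1 \<Longrightarrow> M \<ge> 0 \<Longrightarrow> M / (b + g t) \<le> M"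
  using g_nonneg[of t] divide_left_mono[of 1 "b + g t" M] by simp

lemma V_bound:
  assumes "k > 0" "b \<ge> 1" "M \<ge> 0" "t \<ge> 0"
    and V: "ac_deriv_le 0 V (\<lambda>t. - k * V t + M / (b + g t))"
  shows "V t \<le> V 0 + M / k"
proof -
  have "ac_deriv_le 0 V (\<lambda>s. - k * V s + M)"
    by (intro ac_deriv_le_mono[OF V] AE_lebesgue_on_greaterThanI add_left_mono
        divide_gain_le assms order_refl)
  then have "V t \<le> exp (- k * (t - 0)) * V 0 + M / k"
    by (rule ac_deriv_le_gronwall_nonneg) fact+
  also have "exp (- k * (t - 0)) * V 0 \<le> 1 * V 0"
    using \<open>t \<ge> 0\<close> \<open>k > 0\<close> by (intro mult_right_mono V_nonneg) simp
  finally show ?thesis by simp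
qed

text \<open>Once \<open>b + g\<close> exceeds \<open>M / (k * \<epsilon>)\<close>, the excess of \<open>V\<close> over \<open>\<epsilon>\<close> decays exponentially
  and the gain can only grow by a controlled amount.\<close>

lemma gain_bound:
  assumes "k > 0" "b \<ge> 1" "M \<ge> 0" "t \<ge> 0"
    and V: "ac_deriv_le 0 V (\<lambda>t. - k * V t + M / (b + g t))"
  shows "g t \<le> g 0 + M / (k * \<epsilon>) + \<Gamma> / k * (V 0 + M / k)"
proof (cases "M / (k * \<epsilon>) \<le> b + g t")
  case False
  moreover have "0 \<le> \<Gamma> / k * (V 0 + M / k)"
    using \<Gamma>_pos V_nonneg[of 0] \<open>k > 0\<close> \<open>M \<ge> 0\<close> by simp
  ultimately show ?thesis using g_nonneg[of 0] \<open>b \<ge> 1\<close> by linarith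
next
  case True
  then obtain T where T: "0 \<le> T" "T \<le> t" "M / (k * \<epsilon>) \<le> b + g T" "g T \<le> g 0 + M / (k * \<epsilon>)"
    using gain_crossing[of t b "M / (k * \<epsilon>)"] assms(1-4) \<epsilon>_pos by auto
  have "- k * V s + M / (b + g s) \<le> - k * V s + k * \<epsilon>" if "T < s" for s
  proof -
    have "M / (k * \<epsilon>) \<le> b + g s" using gain_mono[of T s] T that by linarith
    moreover have "0 < b + g s" using \<open>b \<ge> 1\<close> g_nonneg[of s] by linarith
    ultimately show ?thesis using \<open>k > 0\<close> \<epsilon>_pos by (simp add: field_simps)
  qed
  then have "ac_deriv_le T V (\<lambda>s. - k * V s + k * \<epsilon>)"
    by (intro ac_deriv_le_mono[OF V T(1)] AE_lebesgue_on_greaterThanI)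
  then have "V s - \<epsilon> \<le> V T * exp (- k * (s - T))" if "T < s" for s
    using ac_deriv_le_gronwall_nonneg[of T V k "k * \<epsilon>" s] \<open>k > 0\<close> \<epsilon>_pos that
    by (simp add: mult.commute)
  then have "g t \<le> g T + \<Gamma> * V T / k"
    by (rule gain_le_of_exp_decay[OF T(1,2) \<open>k > 0\<close> V_nonneg])
  moreover have "V T \<le> V 0 + M / k"
    by (rule V_bound) fact+
  then have "\<Gamma> / k * V T \<le> \<Gamma> / k * (V 0 + M / k)"
    using \<Gamma>_pos \<open>k > 0\<close> by (intro mult_left_mono) auto
  ultimately show ?thesis using T(4) by simp
qed

text \<open>A Barbalat argument: since \<open>V\<close> grows at rate at most \<open>R\<close>, a late excursion above
  \<open>B\<close> is preceded by an interval of fixed length on which the gain increases by a fixed amount.\<close>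

lemma eventually_less_of_bounded_gain:
  assumes "R > 0" and V: "ac_deriv_le 0 V (\<lambda>_. R)" and bdd: "bdd_above (g ` {0..})" and "\<epsilon> < B"
  shows "\<forall>\<^sub>F t in at_top. V t < B"
proof -
  define \<eta> where "\<eta> = (B - \<epsilon>) / 2"
  define h where "h = \<eta> / R"
  have "\<eta> > 0" "h > 0" unfolding \<eta>_def h_def using \<open>\<epsilon> < B\<close> \<open>R > 0\<close> by auto
  have "mono_on {0..} g" by (rule mono_onI) (auto intro: gain_mono)
  moreover have "\<Gamma> * \<eta> * h > 0" using \<Gamma>_pos \<open>\<eta> > 0\<close> \<open>h > 0\<close> by simp
  ultimately obtain t\<^sub>0 where "0 \<le> t\<^sub>0"
    and small: "\<And>s t. t\<^sub>0 \<le> s \<Longrightarrow> t\<^sub>0 \<le> t \<Longrightarrow> g t < g s + \<Gamma> * \<eta> * h"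
    using mono_bounded_small_increments[OF _ bdd] by metis
  have "V t < B" if t: "t > t\<^sub>0 + h" for t
  proof (rule ccontr)
    assume "\<not> V t < B"
    have "\<eta> \<le> max (V s - \<epsilon>) 0" if s: "t - h < s" "s < t" for s
    proof -
      have "V t - V s \<le> R * t - R * s"
        by (rule ac_deriv_le_increment[OF V]) (use s t \<open>0 \<le> t\<^sub>0\<close> in \<open>auto intro!: derivative_eq_intros\<close>)
      also have "\<dots> \<le> R * h"
        unfolding right_diff_distrib[symmetric] using s \<open>R > 0\<close> by (intro mult_left_mono) auto
      also have "\<dots> = \<eta>" unfolding h_def using \<open>R > 0\<close> by simp
      finally have "\<eta> \<le> V s - \<epsilon>" using \<open>\<not> V t < B\<close> unfolding \<eta>_def by simp
      then show ?thesis by simp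
    qed
    then have "\<Gamma> * \<eta> * (t - (t - h)) \<le> g t - g (t - h)"
      using t \<open>0 \<le> t\<^sub>0\<close> \<open>h > 0\<close> by (intro gain_increment_ge) auto
    moreover have "g t < g (t - h) + \<Gamma> * \<eta> * h"
      using t \<open>h > 0\<close> by (intro small) auto
    ultimately show False by simp
  qed
  then show ?thesis unfolding eventually_at_top_dense by blast
qed

end

subsection \<open>The closed loop\<close>

text \<open>The heat equation enters only through the energy inequality for the norm \<open>N\<close> of its
  state, where \<open>q\<close> stands for \<open>p * pi^2\<close> and \<open>l\<close> for the nonlocal output \<open>t \<mapsto> L(w[t])\<close>.\<close>

locale closed_loop =
  fixes p q c a b \<Gamma> \<epsilon> D \<Theta> :: real and N y z \<theta>1 \<theta>2 l d :: "real \<Rightarrow> real"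
  assumes p_pos: "0 < p" and p_le_q: "p \<le> q" and c_ge: "1 \<le> c"
    and a_pos: "0 < a" and a_le: "a \<le> 1" and b_ge: "1 \<le> b" and \<Gamma>_pos: "0 < \<Gamma>" and \<epsilon>_pos: "0 < \<epsilon>"
    and N_nonneg: "0 \<le> N t"
    and N_ac_deriv_le: "ac_deriv_le 0 (\<lambda>t. (N t)^2)
      (\<lambda>t. - 2 * q * (N t)^2 + 2 * (\<bar>\<theta>1 t\<bar> * \<bar>y t\<bar> * N t))"
    and y_cont: "continuous_on {0..} y" and y_ac: "0 < s \<Longrightarrow> s \<le> r \<Longrightarrow> abs_cont_on s r y"
    and y_deriv: "AE t in lebesgue_on {0<..}.
      (y has_real_derivative control c a (b + exp (z t)) (y t) + \<theta>2 t * l t + d t) (at t)"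
    and z_cont: "continuous_on {0..} z"
    and z_deriv: "0 < t \<Longrightarrow>
      (z has_real_derivative \<Gamma> * exp (- z t) * max ((y t)^2 / 2 - \<epsilon>) 0) (at t)"
    and \<theta>_le: "0 < t \<Longrightarrow> (\<theta>1 t)^2 + (\<theta>2 t)^2 \<le> \<Theta>^2"
    and l_le: "0 < t \<Longrightarrow> \<bar>l t\<bar> \<le> N t"
    and d_le: "AE t in lebesgue_on {0<..}. \<bar>d t\<bar> \<le> D"
begin

definition \<kappa> :: real where
  "\<kappa> = min (q / 2) (2 * c)"

definition initial_energy :: real where
  "initial_energy = (N 0)^2 + (y 0)^2"

definition residual :: real where
  "residual = 2 * a * (D^2 + \<Theta>^8 + 2 / p^2) / (b * \<kappa>) + \<Theta>^4 / (2 * q^2 * \<kappa>)"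

definition forcing :: real where
  "forcing = D^2 + q / 2 * (initial_energy + residual) + \<Theta>^4 / (4 * q^2)"

definition data_size :: real where
  "data_size = D^2 + \<Theta>^4 + \<Theta>^8 + 2 / p^2 + initial_energy"

definition forcing_gain :: real where
  "forcing_gain = (4 * q * (b * \<kappa> + a * q) + 2 * b * \<kappa> * q^2 + b) / (4 * q * b * \<kappa>)"

definition adaptation_gain :: real where
  "adaptation_gain = (a * forcing_gain * (\<epsilon> * \<Gamma> + 2 * c) + \<epsilon> * c * \<Gamma>) / (4 * c^2 * \<epsilon>)"

lemma q_pos: "0 < q"
  using p_pos p_le_q by linarith

lemma \<kappa>_bounds: "0 < \<kappa>" "\<kappa> \<le> q / 2" "\<kappa> \<le> 2 * c"
  unfolding \<kappa>_def using q_pos c_ge by auto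

lemma gain_ratio: "1 \<le> b + exp (z t)" "1 \<le> b / a" "b / a \<le> (b + exp (z t)) / a"
  using a_pos a_le b_ge by (auto simp: add_increasing2 divide_right_mono)

lemma \<theta>1_le: "0 < t \<Longrightarrow> \<bar>\<theta>1 t\<bar> \<le> \<bar>\<Theta>\<bar>" and \<theta>2_le: "0 < t \<Longrightarrow> \<bar>\<theta>2 t\<bar> \<le> \<bar>\<Theta>\<bar>"
  using \<theta>_le[of t] zero_le_power2[of "\<theta>1 t"] zero_le_power2[of "\<theta>2 t"]
  unfolding abs_le_square_iff by linarith+

lemma initial_energy_nonneg: "0 \<le> initial_energy"
  unfolding initial_energy_def by simp

lemma residual_nonneg: "0 \<le> residual"
  unfolding residual_def using a_pos b_ge \<kappa>_bounds(1) by simp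

lemma \<kappa>_residual: "\<kappa> * residual = 2 * ((D^2 + \<Theta>^8 + 2 / p^2) / (b / a)) + \<Theta>^4 / (2 * q^2)"
  unfolding residual_def using \<kappa>_bounds(1) a_pos b_ge p_pos q_pos by (simp add: field_simps)

lemma forcing_nonneg: "0 \<le> forcing"
  unfolding forcing_def using initial_energy_nonneg residual_nonneg q_pos by simp

lemma forcing_le_data_size: "forcing \<le> forcing_gain * data_size"
proof -
  have forcing_gain: "forcing_gain = 1 + a * q / (b * \<kappa>) + q / 2 + 1 / (4 * q * \<kappa>)"
    unfolding forcing_gain_def using q_pos b_ge \<kappa>_bounds(1)
    by (simp add: field_simps power2_eq_square)
  show ?thesis
    unfolding forcing_def residual_def data_size_def forcing_gain
    using b_ge by (intro disturbance_gain_le p_pos p_le_q \<kappa>_bounds a_pos initial_energy_nonneg) simp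
qed

lemma y_square_ac_deriv_le:
  "ac_deriv_le 0 (\<lambda>t. (y t)^2)
    (\<lambda>t. 2 * (y t * (control c a (b + exp (z t)) (y t) + \<theta>2 t * l t + d t)))"
  by (rule ac_deriv_le_square[OF y_cont y_ac y_deriv])

lemma energy_bound:
  assumes "t \<ge> 0"
  shows "(N t)^2 + (y t)^2 \<le> exp (- \<kappa> * t) * initial_energy + residual"
proof -
  have "AE t in lebesgue_on {0<..}. - 2 * q * (N t)^2 + 2 * (\<bar>\<theta>1 t\<bar> * \<bar>y t\<bar> * N t)
        + 2 * (y t * (control c a (b + exp (z t)) (y t) + \<theta>2 t * l t + d t))
      \<le> - \<kappa> * ((N t)^2 + (y t)^2) + \<kappa> * residual"
    using d_le AE_lebesgue_on_greaterThan
  proof eventually_elim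
    case (elim t)
    then show ?case
      using total_energy_decay[OF p_pos p_le_q c_ge a_pos gain_ratio \<theta>_le l_le _ \<kappa>_bounds(2,3), of t]
      unfolding \<kappa>_residual by simp
  qed
  with ac_deriv_le_add[OF N_ac_deriv_le y_square_ac_deriv_le]
  have "ac_deriv_le 0 (\<lambda>t. (N t)^2 + (y t)^2) (\<lambda>t. - \<kappa> * ((N t)^2 + (y t)^2) + \<kappa> * residual)"
    by (rule ac_deriv_le_mono[OF _ order_refl])
  then have "(N t)^2 + (y t)^2 \<le> exp (- \<kappa> * (t - 0)) * ((N 0)^2 + (y 0)^2) + \<kappa> * residual / \<kappa>"
    using \<kappa>_bounds(1) residual_nonneg assms by (intro ac_deriv_le_gronwall_nonneg) auto
  then show ?thesis using \<kappa>_bounds(1) unfolding initial_energy_def by simp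
qed

lemma state_power2_le:
  assumes "t \<ge> 0"
  shows "(N t)^2 \<le> initial_energy + residual"
proof -
  have "exp (- \<kappa> * t) * initial_energy \<le> 1 * initial_energy"
    using assms \<kappa>_bounds(1) initial_energy_nonneg by (intro mult_right_mono) auto
  then show ?thesis using energy_bound[OF assms] zero_le_power2[of "y t"] by linarith
qed

lemma output_ac_deriv_le:
  "ac_deriv_le 0 (\<lambda>t. (y t)^2 / 2) (\<lambda>t. - (2 * c) * ((y t)^2 / 2) + a * forcing / (b + exp (z t)))"
proof -
  have "AE t in lebesgue_on {0<..}. y t * (control c a (b + exp (z t)) (y t) + \<theta>2 t * l t + d t)
      \<le> - (2 * c) * ((y t)^2 / 2) + a * forcing / (b + exp (z t))"
    using d_le AE_lebesgue_on_greaterThan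
  proof eventually_elim
    case (elim t)
    let ?r = "(b + exp (z t)) / a"
    have "1 \<le> ?r" using gain_ratio(2) gain_ratio(3)[of t] by linarith
    have "y t * (control c a (b + exp (z t)) (y t) + \<theta>2 t * l t + d t)
        \<le> - (c * (y t)^2) + (D^2 + q / 2 * (N t)^2 + \<Theta>^4 / (4 * q^2)) / ?r"
      using elim
      by (intro output_energy_decay q_pos c_ge a_pos gain_ratio(1) \<open>1 \<le> ?r\<close> order_refl \<theta>2_le l_le)
    also have "\<dots> \<le> - (c * (y t)^2) + forcing / ?r"
      unfolding forcing_def using state_power2_le[of t] elim(2) q_pos \<open>1 \<le> ?r\<close>
      by (intro add_left_mono divide_right_mono add_mono mult_left_mono order_refl) auto
    finally show ?case by (simp add: mult.commute)
  qed
  moreover have "ac_deriv_le 0 (\<lambda>t. (y t)^2 / 2)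
      (\<lambda>t. y t * (control c a (b + exp (z t)) (y t) + \<theta>2 t * l t + d t))"
    using ac_deriv_le_cmult[OF y_square_ac_deriv_le, of "1/2"] by simp
  ultimately show ?thesis by (rule ac_deriv_le_mono[OF _ order_refl, rotated])
qed

sublocale adaptive_gain "\<lambda>t. (y t)^2 / 2" "\<lambda>t. exp (z t)" \<Gamma> \<epsilon>
proof
  show "((\<lambda>t. exp (z t)) has_real_derivative \<Gamma> * max ((y t)^2 / 2 - \<epsilon>) 0) (at t)" if "0 < t" for t
    using DERIV_fun_exp[OF z_deriv[OF that]] by (simp add: exp_minus field_simps)
qed (use \<Gamma>_pos \<epsilon>_pos in \<open>auto intro!: continuous_intros y_cont z_cont\<close>)

lemma exp_gain_le:
  assumes "t \<ge> 0"
  shows "exp (z t) \<le> exp (z 0) + adaptation_gain * data_size"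
proof -
  define F where "F = forcing_gain * data_size"
  have "exp (z t)
      \<le> exp (z 0) + a * forcing / (2 * c * \<epsilon>) + \<Gamma> / (2 * c) * ((y 0)^2 / 2 + a * forcing / (2 * c))"
    using c_ge a_pos forcing_nonneg by (intro gain_bound[OF _ b_ge _ assms output_ac_deriv_le]) auto
  also have "\<dots> \<le> exp (z 0) + a * F / (2 * c * \<epsilon>) + \<Gamma> / (2 * c) * (data_size / 2 + a * F / (2 * c))"
  proof -
    have "(y 0)^2 \<le> data_size"
      unfolding data_size_def initial_energy_def by simp
    then show ?thesis
      using forcing_le_data_size a_pos c_ge \<epsilon>_pos \<Gamma>_pos unfolding F_def
      by (intro add_mono mult_left_mono divide_right_mono order_refl) auto
  qed
  also have "\<dots> = exp (z 0) + adaptation_gain * data_size"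
    unfolding F_def adaptation_gain_def using c_ge \<epsilon>_pos by (simp add: field_simps power2_eq_square)
  finally show ?thesis .
qed

lemma adaptation_bounds:
  assumes "t \<ge> 0"
  shows "z 0 \<le> z t" "z t \<le> ln (exp (z 0) + adaptation_gain * data_size)"
proof -
  show "z 0 \<le> z t" using gain_mono[of 0 t] assms by simp
  show "z t \<le> ln (exp (z 0) + adaptation_gain * data_size)"
    using exp_gain_le[OF assms] by (subst ln_ge_iff) (auto intro: less_le_trans[OF exp_gt_zero])
qed

lemma output_growth_le: "ac_deriv_le 0 (\<lambda>t. (y t)^2 / 2) (\<lambda>_. a * forcing + 1)"
proof (rule ac_deriv_le_mono[OF output_ac_deriv_le order_refl AE_lebesgue_on_greaterThanI])
  fix t
  have "a * forcing / (b + exp (z t)) \<le> a * forcing"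
    using a_pos forcing_nonneg b_ge by (intro divide_gain_le) auto
  moreover have "0 \<le> 2 * c * ((y t)^2 / 2)" using c_ge by simp
  ultimately show "- (2 * c) * ((y t)^2 / 2) + a * forcing / (b + exp (z t)) \<le> a * forcing + 1"
    by simp
qed

lemma Limsup_output_le: "Limsup at_top (\<lambda>t. ereal \<bar>y t\<bar>) \<le> ereal (sqrt (2 * \<epsilon>))"
  unfolding Limsup_ereal_le_iff
proof (intro allI impI)
  fix B assume B: "sqrt (2 * \<epsilon>) < B"
  moreover have "0 \<le> sqrt (2 * \<epsilon>)" using \<epsilon>_pos by simp
  ultimately have "0 \<le> B" by linarith
  have "2 * \<epsilon> < B^2"
    using power_strict_mono[OF B \<open>0 \<le> sqrt (2 * \<epsilon>)\<close>, of 2] \<epsilon>_pos by simp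
  moreover have "0 < a * forcing + 1"
    using a_pos forcing_nonneg by (simp add: add_nonneg_pos)
  moreover have "bdd_above ((\<lambda>t. exp (z t)) ` {0..})"
    using exp_gain_le by (intro bdd_aboveI2) auto
  ultimately have "\<forall>\<^sub>F t in at_top. (y t)^2 / 2 < B^2 / 2"
    by (intro eventually_less_of_bounded_gain[OF _ output_growth_le]) auto
  then show "\<forall>\<^sub>F t in at_top. \<bar>y t\<bar> < B"
  proof eventually_elim
    case (elim t)
    then have "\<bar>y t\<bar>^2 < B^2" by simp
    then show ?case using \<open>0 \<le> B\<close> by (rule power2_less_imp_less)
  qed
qed

lemma Limsup_state_le:
  "Limsup at_top (\<lambda>t. ereal (N t))
    \<le> ereal (sqrt (2 * \<epsilon>) / q) * Limsup at_top (\<lambda>t. ereal \<bar>\<theta>1 t\<bar>)"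
proof -
  have "\<forall>\<^sub>F t in at_top. \<bar>\<theta>1 t\<bar> \<le> \<bar>\<Theta>\<bar>"
    using eventually_gt_at_top[of 0] by eventually_elim (rule \<theta>1_le)
  then obtain A where A: "Limsup at_top (\<lambda>t. ereal \<bar>\<theta>1 t\<bar>) = ereal A" "0 \<le> A"
    by (rule Limsup_ereal_real[rotated 2]) auto
  have "Limsup at_top (\<lambda>t. ereal (\<bar>\<theta>1 t\<bar> * \<bar>y t\<bar>)) \<le> ereal (A * sqrt (2 * \<epsilon>))"
    using A \<epsilon>_pos by (intro Limsup_mult_le Limsup_output_le) auto
  then have "Limsup at_top (\<lambda>t. ereal (N t)) \<le> ereal (A * sqrt (2 * \<epsilon>) / q)"
    using A \<epsilon>_pos by (intro Limsup_energy_le[OF N_ac_deriv_le N_nonneg q_pos]) auto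
  then show ?thesis unfolding A(1) by (simp add: mult.commute)
qed

end

theorem theorem3:
  fixes p \<epsilon> \<Gamma> c a b :: real
    and K :: "real \<Rightarrow> real \<Rightarrow> real"
    and L :: "(real \<Rightarrow> real) \<Rightarrow> real"
    and d \<theta>1 \<theta>2 y z u :: "real \<Rightarrow> real"
    and w wt wx wxx :: "real \<Rightarrow> real \<Rightarrow> real"
    and \<kappa> Kbar Bbar D \<Theta> :: real
  assumes p_pos: "p > 0"
    and L_bound: "\<forall>f. H2_H01 f \<longrightarrow> \<bar>L f\<bar> \<le> L2norm f"
    and K_bound: "\<forall>x\<in>{0..1}. \<forall>v. \<bar>K x v\<bar> \<le> \<bar>v\<bar>"
    and eps_pos: "\<epsilon> > 0" and Gamma_pos: "\<Gamma> > 0" and c_ge: "c \<ge> 1"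
    and b_ge: "b \<ge> 1" and a_le: "1 \<ge> a" and a_pos: "a > 0"
    and d_Linf: "in_Linf d"
    and theta_cont: "continuous_on {0..} \<theta>1" "continuous_on {0..} \<theta>2"
    and theta_Linf: "in_Linf \<theta>1" "in_Linf \<theta>2"
    \<comment> \<open>w \<in> C^0(R_+; L^2(0,1))\<close>
    and w_C0: "L2_continuous_on {0..} w"
    \<comment> \<open>w \<in> C^1((0,\<infinity>); L^2(0,1)), with derivative wt\<close>
    and wt_deriv: "\<forall>t>0. in_L2 (wt t) \<and>
          ((\<lambda>s. L2norm (\<lambda>x. (w s x - w t x) / (s - t) - wt t x)) \<longlongrightarrow> 0) (at t)"
    and wt_cont: "L2_continuous_on {0<..} wt"
    \<comment> \<open>w \<in> C^0((0,\<infinity>); H^2(0,1) \<inter> H^1_0(0,1)), with x-derivatives wx, wxx\<close>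
    and w_H2: "\<forall>t>0. H2_with (w t) (wx t) (wxx t)"
    and w_H2_cont: "L2_continuous_on {0<..} w" "L2_continuous_on {0<..} wx"
                   "L2_continuous_on {0<..} wxx"
    \<comment> \<open>z \<in> C^1(R_+)\<close>
    and z_C1: "\<exists>z'. continuous_on {0..} z' \<and>
          (\<forall>t\<ge>0. (z has_real_derivative z' t) (at t within {0..}))"
    \<comment> \<open>y continuous on R_+, absolutely continuous on compact intervals\<close>
    and y_cont: "continuous_on {0..} y"
    and y_ac: "\<forall>s r. 0 \<le> s \<longrightarrow> s \<le> r \<longrightarrow> abs_cont_on s r y"
    \<comment> \<open>the PDE and boundary conditions, for all t > 0\<close>
    and pde: "\<forall>t>0. AE x in lebesgue_on {0..1}. wt t x = p * wxx t x + \<theta>1 t * K x (y t)"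
    and bc: "\<forall>t>0. w t 0 = 0 \<and> w t 1 = 0"
    \<comment> \<open>the ODE for y, a.e. t > 0\<close>
    and ode_y: "AE t in lebesgue_on {0<..}.
          (y has_real_derivative (u t + \<theta>2 t * L (w t) + d t)) (at t)"
    \<comment> \<open>the controller\<close>
    and u_def: "\<forall>t>0. u t = - c * (1 + (b + exp (z t))^7 / (4 * a^6)) * (y t^7 + y t^3 + y t)"
    and ode_z: "\<forall>t>0. (z has_real_derivative
          (\<Gamma> * exp (- z t) * max (y t ^ 2 / 2 - \<epsilon>) 0)) (at t)"
    and D_def: "D = ess_norm d"
    and Theta_def: "\<Theta> = ess_norm (\<lambda>t. sqrt ((\<theta>1 t)^2 + (\<theta>2 t)^2))"
    and kappa_def: "\<kappa> = min (p * pi^2 / 2) (2 * c)"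
    and Kbar_def: "Kbar = (4 * p * pi^2 * (b * \<kappa> + a * p * pi^2) + 2 * b * \<kappa> * p^2 * pi^4 + b)
                          / (4 * p * pi^2 * b * \<kappa>)"
    and Bbar_def: "Bbar = (a * Kbar * (\<epsilon> * \<Gamma> + 2 * c) + \<epsilon> * c * \<Gamma>) / (4 * c^2 * \<epsilon>)"
  shows "(\<forall>t\<ge>0. (L2norm (w t))^2 + (y t)^2
            \<le> exp (- \<kappa> * t) * ((L2norm (w 0))^2 + (y 0)^2)
              + 2 * a * (D^2 + \<Theta>^8 + 2 / p^2) / (b * \<kappa>)
              + \<Theta>^4 / (2 * p^2 * pi^4 * \<kappa>))
       \<and> (\<forall>t\<ge>0. z 0 \<le> z t \<and>
            z t \<le> ln (exp (z 0) + Bbar * (D^2 + \<Theta>^4 + \<Theta>^8 + 2 / p^2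
                                           + (L2norm (w 0))^2 + (y 0)^2)))
       \<and> Limsup at_top (\<lambda>t. ereal (L2norm (w t)))
            \<le> ereal (sqrt (2 * \<epsilon>) / (p * pi^2)) * Limsup at_top (\<lambda>t. ereal \<bar>\<theta>1 t\<bar>)
       \<and> Limsup at_top (\<lambda>t. ereal \<bar>y t\<bar>) \<le> ereal (sqrt (2 * \<epsilon>))"
proof -
  have "ac_deriv_le 0 (\<lambda>t. (L2norm (w t))^2)
      (\<lambda>t. - 2 * (p * pi^2) * (L2norm (w t))^2 + 2 * (\<bar>\<theta>1 t\<bar> * \<bar>y t\<bar> * L2norm (w t)))"
    using p_pos wt_deriv w_H2 bc pde K_bound
    by (intro heat_L2norm_power2_ac_deriv_le[OF w_C0 wt_cont]) (auto simp: abs_mult mult_left_mono)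
  moreover have "AE t in lebesgue_on {0<..}.
      (y has_real_derivative control c a (b + exp (z t)) (y t) + \<theta>2 t * L (w t) + d t) (at t)"
    using ode_y AE_lebesgue_on_greaterThan by eventually_elim (use u_def in \<open>simp add: control_def\<close>)
  moreover have "AE t in lebesgue_on {0<..}. \<bar>d t\<bar> \<le> D"
    unfolding D_def by (rule AE_lebesgue_on_subset[OF in_Linf_AE_le_ess_norm[OF d_Linf]]) auto
  moreover have "continuous_on {0..} z"
    using z_C1 by (auto intro: DERIV_continuous_on)
  moreover have "\<bar>L (w t)\<bar> \<le> L2norm (w t)" if "0 < t" for t
    using L_bound w_H2 bc that unfolding H2_H01_def by blast
  ultimately interpret loop: closed_loop p "p * pi^2" c a b \<Gamma> \<epsilon> D \<Theta> "\<lambda>t. L2norm (w t)" y z \<theta>1 \<theta>2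
    "\<lambda>t. L (w t)" d
    using p_pos pi_ge_two c_ge a_pos a_le b_ge Gamma_pos eps_pos y_cont y_ac ode_z Theta_def
      sum_squares_le_ess_norm[OF theta_Linf(1) theta_cont(1) theta_Linf(2) theta_cont(2)]
    by unfold_locales (auto intro!: one_le_power)
  have \<kappa>: "loop.\<kappa> = \<kappa>" unfolding loop.\<kappa>_def kappa_def ..
  have constants: "loop.forcing_gain = Kbar"
    "loop.residual = 2 * a * (D^2 + \<Theta>^8 + 2 / p^2) / (b * \<kappa>) + \<Theta>^4 / (2 * p^2 * pi^4 * \<kappa>)"
    unfolding loop.forcing_gain_def loop.residual_def Kbar_def \<kappa>
    by (simp_all add: power_mult_distrib mult.assoc)
  show ?thesis
    using loop.energy_bound loop.adaptation_bounds loop.Limsup_state_le loop.Limsup_output_le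
    unfolding \<kappa> constants Bbar_def
      loop.adaptation_gain_def loop.initial_energy_def loop.data_size_def
    by (simp add: add.assoc)
qed

end
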